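(* There exists a universal constant $C > 0$ such that the following holds. Let $\delta > 0$ and let $V = \{v_1,\ldots,v_n\} \subset \mathbb{C}^d$ be a set of $n$ distinct points. Suppose that there are at least $\delta n^2$ unordered pairs of points in $V$ that lie on a special line. Then there exists a subset $V' \subset V$ such that $|V'| \geq (\delta/6)n$ and $\operatorname{affine-dim}(V') \leq C/\delta$.
   Context: Given a finite set of points in $\mathbb{C}^d$, a (complex) line is called special if it passes through at least three of the points of the set. $\operatorname{affine-dim}(V')$ is the (complex) dimension of the affine span of $V'$. *)

theory Defs
  imports Complex_Main "Jordan_Normal_Form.VS_Connect"
begin

text \<open>
  The space \<open>\<complex>\<^sup>d\<close> is the carrier \<open>carrier_vec d\<close> of vectors of length \<open>d\<close>. The dimension is thus an
  ordinary natural number, so that a constant can be quantified before it (with an index type in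
  place of \<open>d\<close>, the constant would be allowed to depend on the dimension).
\<close>

context vec_space
begin

definition affine_span :: "'a vec set \<Rightarrow> 'a vec set" where
  "affine_span S = {lincomb c T | c T. finite T \<and> T \<subseteq> S \<and> (\<Sum>v\<in>T. c v) = 1}"

text \<open>
  The dimension of an affine subspace is that of its direction, the linear space of the differences
  of its points. For nonempty \<open>S\<close> the outer \<open>span\<close> changes nothing, since these differences already
  form a subspace. The dimension of the empty set is \<open>0\<close> here.
\<close>

definition affine_dim :: "'a vec set \<Rightarrow> nat" where
  "affine_dim S =
     vectorspace.dim class_ring
       (vs (span {x - y | x y. x \<in> affine_span S \<and> y \<in> affine_span S}))"

end

definition complex_line :: "nat \<Rightarrow> complex vec set \<Rightarrow> bool" where
  "complex_line d L \<longleftrightarrow>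
     (\<exists>a \<in> carrier_vec d. \<exists>u \<in> carrier_vec d.
        u \<noteq> 0\<^sub>v d \<and> L = {a + t \<cdot>\<^sub>v u | t. True})"

text \<open>Meant for finite \<open>V\<close> only, as \<open>card\<close> is \<open>0\<close> on infinite sets.\<close>

definition special_line :: "nat \<Rightarrow> complex vec set \<Rightarrow> complex vec set \<Rightarrow> bool" where
  "special_line d V L \<longleftrightarrow> complex_line d L \<and> card (L \<inter> V) \<ge> 3"

text \<open>Unordered pairs of points are represented as two-element sets.\<close>

definition special_pairs :: "nat \<Rightarrow> complex vec set \<Rightarrow> complex vec set set" where
  "special_pairs d V =
     {{x, y} | x y. x \<in> V \<and> y \<in> V \<and> x \<noteq> y \<and>
        (\<exists>L. special_line d V L \<and> x \<in> L \<and> y \<in> L)}"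

end

theory Submission
  imports Defs
begin

text \<open>
  Weight every ordered collinear triple of distinct points of \<open>V\<close> by \<open>1 / (r - 2)\<close>, where \<open>r\<close> is the
  number of points of \<open>V\<close> on its line. Each special ordered pair then has total weight \<open>1\<close>, and a subset
  \<open>S\<close> of \<open>V\<close> maximizing the weight inside \<open>S\<close> minus \<open>\<delta> n |S| / 2\<close> has weight at least \<open>K = \<delta> n / 6\<close> at
  each of its points; in particular \<open>|S| \<ge> K\<close>.

  To bound the dimension, consider the functions on \<open>S\<close> satisfying the relations of all collinear
  triples, and among their independent families one that maximizes the ratio \<open>c = D / N\<close> of its size to
  the size of its support. Evaluation turns the support into \<open>N\<close> vectors \<open>x\<^sub>i\<close> in \<open>\<complex>\<^sup>D\<close>, and maximality
  allows positive weights \<open>l\<^sub>i\<close> such that, with \<open>G = \<Sum> l\<^sub>i x\<^sub>i x\<^sub>i\<^sup>*\<close> and \<open>Q\<^sub>i\<^sub>j = x\<^sub>i\<^sup>* G\<^sup>-\<^sup>1 x\<^sub>j\<close>, all \<open>l\<^sub>i Q\<^sub>i\<^sub>i\<close>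
  are at least \<open>c / 2\<close>. Now \<open>\<Sum> l\<^sub>i l\<^sub>j |Q\<^sub>i\<^sub>j|\<^sup>2 = D\<close>, whereas every dependent triple contributes at least
  \<open>c\<^sup>2 / 8\<close> to this sum. Hence \<open>D \<ge> N K c\<^sup>2 / 24\<close>, that is \<open>c \<le> 24 / K\<close>.
\<close>

section \<open>Determinants under rank-one updates\<close>

text \<open>The bordered matrix \<open>M\<close> is block-triangularised in two ways by factors of
  determinant 1: on the left by \<open>L1\<close>, where \<open>H * S = 1\<close> clears the lower
  left block, and on the right by \<open>L2\<close>, which leaves the updated matrix in the
  corner.\<close>

lemma det_rank_one_update:
  fixes S H :: "'a::idom mat" and u v :: "nat \<Rightarrow> 'a"
  assumes S: "S \<in> carrier_mat D D" and H: "H \<in> carrier_mat D D" and HS: "H * S = 1\<^sub>m D"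
  shows "det (S + mat D D (\<lambda>(r, s). u r * v s)) =
    det S * (1 + (\<Sum>r<D. \<Sum>s<D. v r * H $$ (r, s) * u s))"
proof -
  define U where "U = mat D 1 (\<lambda>(r, s). u r)"
  define W where "W = mat 1 D (\<lambda>(r, s). v s)"
  have U: "U \<in> carrier_mat D 1" and W: "W \<in> carrier_mat 1 D" by (auto simp: U_def W_def)
  have UW: "U * W = mat D D (\<lambda>(r, s). u r * v s)"
    by (rule eq_matI) (auto simp: U_def W_def scalar_prod_def)
  define M where "M = four_block_mat S U (- W) (1\<^sub>m 1)"
  define L1 where "L1 = four_block_mat (1\<^sub>m D) (0\<^sub>m D 1) (W * H) (1\<^sub>m 1)"
  define L2 where "L2 = four_block_mat (1\<^sub>m D) (0\<^sub>m D 1) W (1\<^sub>m 1)"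
  have c: "M \<in> carrier_mat (D + 1) (D + 1)" "L1 \<in> carrier_mat (D + 1) (D + 1)"
      "L2 \<in> carrier_mat (D + 1) (D + 1)"
    unfolding M_def L1_def L2_def using S by (auto intro!: four_block_carrier_mat)
  have WH: "W * H \<in> carrier_mat 1 D" using W H by auto
  have d1: "det L1 = 1" "det L2 = 1"
    unfolding L1_def L2_def
    by (subst det_four_block_mat_upper_right_zero[where n = D and m = 1]; use WH W in auto)+
  have WHS: "W * H * S = W"
    using assoc_mult_mat[OF W H S] HS W by simp
  have "L1 * M = four_block_mat S U (0\<^sub>m 1 D) (W * H * U + 1\<^sub>m 1)"
    unfolding L1_def M_def
    apply (subst mult_four_block_mat[OF one_carrier_mat zero_carrier_mat WH one_carrier_mat S U _ one_carrier_mat])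
    using S U W WH WHS by (auto intro!: eq_matI)
  then have "det L1 * det M = det S * det (W * H * U + 1\<^sub>m 1)"
    using det_mult[OF c(2) c(1)]
      det_four_block_mat_lower_left_zero[OF S U refl, of "W * H * U + 1\<^sub>m 1"] WH U by simp
  moreover have "M * L2 = four_block_mat (S + U * W) U (0\<^sub>m 1 D) (1\<^sub>m 1)"
    unfolding L2_def M_def
    apply (subst mult_four_block_mat[OF S U _ one_carrier_mat one_carrier_mat zero_carrier_mat W one_carrier_mat])
    using S U W by (auto intro!: eq_matI)
  then have "det M * det L2 = det (S + U * W) * 1"
    using det_mult[OF c(1) c(3)]
      det_four_block_mat_lower_left_zero[of "S + U * W" D U 1 _ "1\<^sub>m 1"] S U W by simp
  moreover have "det (W * H * U + 1\<^sub>m 1) = (W * H * U + 1\<^sub>m 1) $$ (0, 0)"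
    using WH U by (intro det_single) auto
  moreover have "(X * U) $$ (0, 0) = (\<Sum>s<D. X $$ (0, s) * u s)" if "X \<in> carrier_mat 1 D" for X
    using that by (auto simp: scalar_prod_def U_def atLeast0LessThan)
  then have "(W * H * U) $$ (0, 0) = (\<Sum>s<D. (W * H) $$ (0, s) * u s)" using WH by blast
  moreover have "\<dots> = (\<Sum>s<D. \<Sum>r<D. v r * H $$ (r, s) * u s)"
    using W H by (auto simp: scalar_prod_def W_def atLeast0LessThan sum_distrib_right intro!: sum.cong)
  ultimately show ?thesis
    using d1 WH U UW sum.swap[of "\<lambda>s r. v r * H $$ (r, s) * u s" "{..<D}" "{..<D}"]
    by (simp add: add.commute)
qed

section \<open>Independent families of functions\<close>

text \<open>Families instead of sets of functions, so that a repetition counts as a dependence. Read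
  dually for finite \<open>A\<close>, the vectors of values \<open>e a i\<close> with
  \<open>a \<in> A\<close>, one for each \<open>i \<in> I\<close>, span the whole space of vectors
  indexed by \<open>A\<close>.\<close>

definition indep_on :: "'i set \<Rightarrow> nat set \<Rightarrow> (nat \<Rightarrow> 'i \<Rightarrow> complex) \<Rightarrow> bool" where
  "indep_on I A e \<longleftrightarrow>
     (\<forall>c. (\<forall>i\<in>I. (\<Sum>a\<in>A. c a * e a i) = 0) \<longrightarrow> (\<forall>a\<in>A. c a = 0))"

definition supp :: "'i set \<Rightarrow> nat set \<Rightarrow> (nat \<Rightarrow> 'i \<Rightarrow> complex) \<Rightarrow> 'i set" where
  "supp I A e = {i \<in> I. \<exists>a\<in>A. e a i \<noteq> 0}"

lemma indep_on_mono: "indep_on I A e \<Longrightarrow> I \<subseteq> J \<Longrightarrow> indep_on J A e"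
  unfolding indep_on_def by (meson subsetD)

lemma indep_on_supp: "indep_on (supp I A e) A e \<longleftrightarrow> indep_on I A e"
proof
  assume "indep_on I A e"
  then show "indep_on (supp I A e) A e"
    unfolding indep_on_def supp_def
    by (smt (verit, best) mem_Collect_eq mult_eq_0_iff sum.neutral)
qed (auto elim!: indep_on_mono simp: supp_def)

section \<open>Gaussian elimination with pivot \<open>e p i0\<close>\<close>

context
  fixes e :: "nat \<Rightarrow> 'i \<Rightarrow> complex" and A :: "nat set" and p :: nat and i0 :: 'i
  assumes fin: "finite A" and p: "p \<in> A" and nz: "e p i0 \<noteq> 0"
begin

text \<open>The coefficient \<open>c' p\<close> collects the multiples of \<open>e p\<close>
  subtracted from the other functions; it is the unique one for which the combination vanishes at
  \<open>i0\<close>.\<close>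

lemma sum_eliminate:
  fixes c
  defines "c' \<equiv> c(p := - (\<Sum>b\<in>A - {p}. c b * e b i0) / e p i0)"
  shows "(\<Sum>b\<in>A - {p}. c b * (e b i - e b i0 / e p i0 * e p i)) = (\<Sum>b\<in>A. c' b * e b i)"
proof -
  have "(\<Sum>b\<in>A. c' b * e b i) = c' p * e p i + (\<Sum>b\<in>A - {p}. c' b * e b i)"
    using fin p by (simp add: sum.remove)
  also have "(\<Sum>b\<in>A - {p}. c' b * e b i) = (\<Sum>b\<in>A - {p}. c b * e b i)"
    by (auto simp: c'_def intro!: sum.cong)
  finally show ?thesis
    by (simp add: c'_def algebra_simps sum_subtractf sum_distrib_left sum_distrib_right
        sum_divide_distrib sum_negf)
qed

lemma indep_on_eliminate:
  assumes "indep_on I A e"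
  shows "indep_on (I - {i0}) (A - {p}) (\<lambda>b i. e b i - e b i0 / e p i0 * e p i)"
  unfolding indep_on_def
proof (intro allI impI ballI)
  fix c b
  assume c: "\<forall>i\<in>I - {i0}. (\<Sum>b\<in>A - {p}. c b * (e b i - e b i0 / e p i0 * e p i)) = 0"
    and b: "b \<in> A - {p}"
  define c' where "c' = c(p := - (\<Sum>b\<in>A - {p}. c b * e b i0) / e p i0)"
  have "(\<Sum>b\<in>A. c' b * e b i) = 0" if "i \<in> I" for i
  proof (cases "i = i0")
    case True
    then show ?thesis using sum_eliminate[of c i] nz by (simp add: c'_def)
  next
    case False
    then show ?thesis using sum_eliminate[of c i] c that by (simp add: c'_def)
  qed
  with assms have "\<forall>a\<in>A. c' a = 0" unfolding indep_on_def by blast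
  then show "c b = 0" using b by (auto simp: c'_def)
qed

text \<open>Vanishing at \<open>i0\<close> forces the coefficient of \<open>p\<close> to be the one
  in \<open>sum_eliminate\<close>, so a relation of the original family is a relation of the
  eliminated one.\<close>

lemma indep_on_eliminate_rev:
  assumes "indep_on B (A - {p}) (\<lambda>b i. e b i - e b i0 / e p i0 * e p i)"
  shows "indep_on (insert i0 B) A e"
  unfolding indep_on_def
proof (intro allI impI ballI)
  fix c b
  assume c: "\<forall>i\<in>insert i0 B. (\<Sum>a\<in>A. c a * e a i) = 0" and b: "b \<in> A"
  have "c p * e p i0 + (\<Sum>b\<in>A - {p}. c b * e b i0) = 0"
    using c fin p by (simp add: sum.remove)
  then have "c p = - (\<Sum>b\<in>A - {p}. c b * e b i0) / e p i0"
    using nz by (simp add: field_simps add_eq_0_iff)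
  then have "c = c(p := - (\<Sum>b\<in>A - {p}. c b * e b i0) / e p i0)" by (simp add: fun_upd_idem)
  then have "(\<Sum>b\<in>A - {p}. c b * (e b i - e b i0 / e p i0 * e p i)) = 0" if "i \<in> B" for i
    using sum_eliminate[of c i] c that by simp
  with assms have z: "\<forall>b\<in>A - {p}. c b = 0" unfolding indep_on_def by blast
  then have "c p = 0"
    using \<open>c p * e p i0 + _ = 0\<close> nz by simp
  with z b show "c b = 0" by auto
qed

end

text \<open>Induction on the points: a point where all functions vanish is dropped, and otherwise
  elimination removes one point together with one function.\<close>

lemma card_indep_le:
  assumes "finite I" "finite A" "indep_on I A e"
  shows "card A \<le> card I"
  using assms
proof (induction I arbitrary: A e rule: finite_induct)
  case empty
  then show ?case by (fastforce simp: indep_on_def dest: spec[of _ "\<lambda>_. 1"])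
next
  case (insert i I)
  show ?case
  proof (cases "\<exists>p\<in>A. e p i \<noteq> 0")
    case True
    then obtain p where p: "p \<in> A" "e p i \<noteq> 0" by blast
    have "indep_on I (A - {p}) (\<lambda>b j. e b j - e b i / e p i * e p j)"
      using indep_on_eliminate[OF insert.prems(1) p insert.prems(2)] insert.hyps by simp
    then have "card (A - {p}) \<le> card I" using insert by simp
    then show ?thesis using insert p by (simp add: card_Diff_singleton)
  next
    case False
    then have "indep_on I A e" using insert.prems by (auto simp: indep_on_def)
    then show ?thesis using insert by fastforce
  qed
qed

text \<open>The greedy algorithm for a basis of maximal weight. If the dimension \<open>card A\<close> of the span
  equals \<open>c * card I\<close>, the term with \<open>M\<close> vanishes; it is what makes the induction work.\<close>

lemma heavy_basis:
  fixes e :: "nat \<Rightarrow> 'i \<Rightarrow> complex" and w :: "'i \<Rightarrow> real"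
  assumes "finite I" "finite A" "indep_on I A e" "\<And>a. a \<in> A \<Longrightarrow> e a \<in> R"
    and R: "\<And>f g t. f \<in> R \<Longrightarrow> g \<in> R \<Longrightarrow> (\<lambda>i. f i - t * g i) \<in> R"
    and slope: "\<And>A' e'. finite A' \<Longrightarrow> indep_on I A' e' \<Longrightarrow> (\<And>a. a \<in> A' \<Longrightarrow> e' a \<in> R)
      \<Longrightarrow> real (card A') \<le> c * real (card (supp I A' e'))"
    and c: "0 \<le> c"
    and M: "\<And>i. i \<in> I \<Longrightarrow> w i \<le> M"
  shows "\<exists>B\<subseteq>I. card B = card A \<and> indep_on B A e \<and>
    (\<Sum>i\<in>B. w i) \<ge> c * (\<Sum>i\<in>I. w i) - (c * card I - card A) * M"
  using assms
proof (induction "card I" arbitrary: I A e R M)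
  case 0
  then have "I = {}" by simp
  moreover from this 0 have "card A = 0" using card_indep_le[of "{}" A e] by simp
  ultimately show ?case using 0 by auto
next
  case (Suc n)
  note fI = \<open>finite I\<close> and fA = \<open>finite A\<close> and ind = \<open>indep_on I A e\<close> and slope = Suc.prems(6)
    and M = Suc.prems(8) and R = Suc.prems(5) and eR = Suc.prems(4)
  have ne: "I \<noteq> {}" using Suc.hyps by auto
  \<comment> \<open>The greedy choice: a heaviest point, whose weight then serves as the bound
    \<open>M\<close> for the remaining points.\<close>
  obtain i0 where i0: "i0 \<in> I" "\<And>i. i \<in> I \<Longrightarrow> w i \<le> w i0"
    using obtains_MAX[OF fI ne, of w] fI by (metis Max_ge finite_imageI imageI)
  define J where "J = I - {i0}"
  have cJ: "card J = n" "finite J" "card I = Suc n" and IJ: "I = insert i0 J" "i0 \<notin> J"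
    using Suc.hyps(2) i0 fI by (auto simp: J_def)
  \<comment> \<open>Families from \<open>R0\<close> have the same support in \<open>J\<close> as in
    \<open>I\<close>, so the slope condition passes to \<open>J\<close> with the same
    \<open>c\<close>.\<close>
  define R0 where "R0 = {f \<in> R. f i0 = 0}"
  have R0: "\<And>f g t. f \<in> R0 \<Longrightarrow> g \<in> R0 \<Longrightarrow> (\<lambda>i. f i - t * g i) \<in> R0"
    using R by (auto simp: R0_def)
  have slope0: "real (card A') \<le> c * real (card (supp J A' e'))"
    if "finite A'" "indep_on J A' e'" "\<And>a. a \<in> A' \<Longrightarrow> e' a \<in> R0" for A' e'
  proof -
    have "supp J A' e' = supp I A' e'" using that IJ by (auto simp: supp_def R0_def)
    moreover have "indep_on I A' e'" using indep_on_mono[OF that(2), of I] IJ by auto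
    ultimately show ?thesis using slope[OF that(1), of e'] that(3) by (auto simp: R0_def)
  qed
  \<comment> \<open>The factor in front of \<open>M\<close> is nonnegative, so a bound with
    \<open>w i0\<close> in place of \<open>M\<close> is at least as good.\<close>
  have ex: "real (card A) \<le> c * card I"
  proof -
    have "real (card A) \<le> c * real (card (supp I A e))" by (rule slope[OF fA ind eR])
    also have "\<dots> \<le> c * card I"
      using c fI by (intro mult_left_mono) (auto simp: supp_def intro!: card_mono)
    finally show ?thesis .
  qed
  have s: "(\<Sum>i\<in>I. w i) = w i0 + (\<Sum>i\<in>J. w i)" using IJ cJ by simp
  have fin: "(c * card I - card A) * w i0 \<le> (c * card I - card A) * M"
    using ex M[OF i0(1)] by (intro mult_left_mono) auto
  have IH: "\<exists>B\<subseteq>J. card B = card A' \<and> indep_on B A' e' \<and>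
      (\<Sum>i\<in>B. w i) \<ge> c * (\<Sum>i\<in>J. w i) - (c * card J - card A') * w i0"
    if "finite A'" "indep_on J A' e'" "\<And>a. a \<in> A' \<Longrightarrow> e' a \<in> R0" for A' e'
    by (rule Suc.hyps(1)[OF _ cJ(2) that R0 slope0 c]) (use cJ(1) i0 IJ in simp_all)
  show ?case
  proof (cases "\<exists>p\<in>A. e p i0 \<noteq> 0")
    case True
    then obtain p where p: "p \<in> A" "e p i0 \<noteq> 0" by blast
    define e' where "e' = (\<lambda>b i. e b i - e b i0 / e p i0 * e p i)"
    have "indep_on J (A - {p}) e'"
      using indep_on_eliminate[OF fA p ind] by (simp add: J_def e'_def)
    moreover have "e' a \<in> R0" if "a \<in> A - {p}" for a
      using R[OF eR[of a] eR[OF p(1)], of "e a i0 / e p i0"] that p(2) by (auto simp: e'_def R0_def)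
    ultimately obtain B where B: "B \<subseteq> J" "card B = card (A - {p})" "indep_on B (A - {p}) e'"
        "(\<Sum>i\<in>B. w i) \<ge> c * (\<Sum>i\<in>J. w i) - (c * card J - card (A - {p})) * w i0"
      using IH[of "A - {p}" e'] fA by blast
    have fB: "finite B" "i0 \<notin> B" using B(1) cJ IJ finite_subset by auto
    have cA: "real (card A) = real (card (A - {p})) + 1"
      using p fA card_Suc_Diff1[of A p] by linarith
    \<comment> \<open>Choosing \<open>i0\<close> contributes the full \<open>w i0\<close>, which
      exactly offsets the loss of one function in the error term. Without a pivot nothing is gained,
      but \<open>card A\<close> is unchanged; both cases give the same bound.\<close>
    have "(\<Sum>i\<in>insert i0 B. w i) \<ge> c * (\<Sum>i\<in>I. w i) - (c * card I - card A) * w i0"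
      using B(4) fB unfolding s cA cJ by (simp add: algebra_simps)
    then have "(\<Sum>i\<in>insert i0 B. w i) \<ge> c * (\<Sum>i\<in>I. w i) - (c * card I - card A) * M"
      using fin by linarith
    moreover have "card (insert i0 B) = card A" using fB B(2) cA by simp
    moreover have "indep_on (insert i0 B) A e"
      using indep_on_eliminate_rev[where e = e, OF fA p] B(3) by (simp add: e'_def)
    ultimately show ?thesis using B(1) IJ by (intro exI[of _ "insert i0 B"]) auto
  next
    case False
    have "indep_on J A e" using ind False IJ by (auto simp: indep_on_def)
    moreover have "e a \<in> R0" if "a \<in> A" for a using eR False that by (auto simp: R0_def)
    ultimately obtain B where B: "B \<subseteq> J" "card B = card A" "indep_on B A e"
        "(\<Sum>i\<in>B. w i) \<ge> c * (\<Sum>i\<in>J. w i) - (c * card J - card A) * w i0"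
      using IH[of A e] fA by blast
    have "(\<Sum>i\<in>B. w i) \<ge> c * (\<Sum>i\<in>I. w i) - (c * card I - card A) * w i0"
      using B(4) unfolding s cJ by (simp add: algebra_simps)
    then show ?thesis using B IJ fin by (intro exI[of _ B]) auto
  qed
qed

section \<open>Weighted Gram matrices and radial isotropy\<close>

text \<open>The weighted frame operator of the vectors with entries \<open>e r i\<close>,
  \<open>r < D\<close>; it is the \<open>G\<close> of the overview. Real weights make it
  Hermitian.\<close>

definition gram :: "nat \<Rightarrow> (nat \<Rightarrow> 'i \<Rightarrow> complex) \<Rightarrow> ('i \<Rightarrow> real) \<Rightarrow> 'i set \<Rightarrow> complex mat" where
  "gram D e l I = mat D D (\<lambda>(r, s). \<Sum>i\<in>I. of_real (l i) * e r i * cnj (e s i))"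

lemma gram_carrier [simp]: "gram D e l I \<in> carrier_mat D D"
  by (simp add: gram_def)

lemma gram_hermitian: "r < D \<Longrightarrow> s < D \<Longrightarrow> cnj (gram D e l I $$ (r, s)) = gram D e l I $$ (s, r)"
  by (simp add: gram_def mult_ac)

lemma gram_insert:
  assumes "finite J" "i \<notin> J"
  shows "gram D e l (insert i J) =
    gram D e l J + mat D D (\<lambda>(r, s). of_real (l i) * e r i * cnj (e s i))"
  using assms by (intro eq_matI) (auto simp: gram_def)

lemma gram_double:
  assumes "finite I" "i \<in> I"
  shows "gram D e (l(i := 2 * l i)) I =
    gram D e l I + mat D D (\<lambda>(r, s). of_real (l i) * e r i * cnj (e s i))"
proof (rule eq_matI)
  fix r s assume "r < dim_row (gram D e l I + mat D D (\<lambda>(r, s). of_real (l i) * e r i * cnj (e s i)))"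
    "s < dim_col (gram D e l I + mat D D (\<lambda>(r, s). of_real (l i) * e r i * cnj (e s i)))"
  then have "r < D" "s < D" by auto
  moreover have "(\<Sum>j\<in>I - {i}. of_real ((l(i := 2 * l i)) j) * e r j * cnj (e s j)) =
      (\<Sum>j\<in>I - {i}. of_real (l j) * e r j * cnj (e s j))"
    by (intro sum.cong) auto
  ultimately show "gram D e (l(i := 2 * l i)) I $$ (r, s) =
    (gram D e l I + mat D D (\<lambda>(r, s). of_real (l i) * e r i * cnj (e s i))) $$ (r, s)"
    using assms by (simp add: gram_def sum.remove[of I i] algebra_simps)
qed (auto simp: gram_def)

text \<open>With exactly \<open>D\<close> points the matrix factors as \<open>X * L l * Y\<close>,
  where \<open>X\<close> is square, \<open>L l\<close> is diagonal and \<open>Y\<close> is the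
  adjoint of \<open>X\<close>. The witness is \<open>z = det X\<close>, which does not depend on the
  weights.\<close>

lemma det_gram_card:
  assumes B: "finite B" "card B = D"
  obtains z where "\<And>l. det (gram D e l B) = of_real ((\<Prod>i\<in>B. l i) * (cmod z)\<^sup>2)"
    and "indep_on B {..<D} e \<Longrightarrow> z \<noteq> 0"
proof -
  obtain h where h: "bij_betw h {0..<D} B" using ex_bij_betw_nat_finite B by metis
  define X where "X = mat D D (\<lambda>(r, b). e r (h b))"
  define Y where "Y = mat D D (\<lambda>(b, s). cnj (e s (h b)))"
  define L where "L l = mat D D (\<lambda>(b, b'). if b = b' then complex_of_real (l (h b)) else 0)" for l
  interpret cnj: comm_ring_hom cnj by unfold_locales auto
  have X: "X \<in> carrier_mat D D" and Y: "Y \<in> carrier_mat D D" and L: "L l \<in> carrier_mat D D" for l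
    by (auto simp: X_def Y_def L_def)
  have "Y = map_mat cnj (transpose_mat X)" by (rule eq_matI) (auto simp: X_def Y_def)
  then have dY: "det Y = cnj (det X)" using cnj.hom_det[of "transpose_mat X"] det_transpose[OF X] by simp
  have dL: "det (L l) = of_real (\<Prod>i\<in>B. l i)" for l
  proof -
    have "upper_triangular (L l)" by (auto simp: L_def)
    then have "det (L l) = prod_list (diag_mat (L l))" using det_upper_triangular L by blast
    also have "\<dots> = (\<Prod>b\<in>{0..<D}. complex_of_real (l (h b)))"
      unfolding prod_list_diag_prod using L[of l] by (auto simp: L_def intro!: prod.cong)
    also have "\<dots> = (\<Prod>i\<in>B. complex_of_real (l i))"
      by (rule prod.reindex_bij_betw[OF h])
    finally show ?thesis by simp
  qed
  have XL: "X * L l = mat D D (\<lambda>(r, b). e r (h b) * of_real (l (h b)))" for l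
    by (rule eq_matI) (auto simp: X_def L_def scalar_prod_def if_distrib sum.delta cong: if_cong)
  have "gram D e l B = X * L l * Y" for l
  proof (rule eq_matI)
    fix r s assume "r < dim_row (X * L l * Y)" "s < dim_col (X * L l * Y)"
    then have rs: "r < D" "s < D" by (auto simp: X_def Y_def)
    have "(X * L l * Y) $$ (r, s) = (\<Sum>b\<in>{0..<D}. e r (h b) * of_real (l (h b)) * cnj (e s (h b)))"
      unfolding XL using rs by (simp add: Y_def scalar_prod_def)
    also have "\<dots> = (\<Sum>i\<in>B. e r i * of_real (l i) * cnj (e s i))"
      by (rule sum.reindex_bij_betw[OF h])
    finally show "gram D e l B $$ (r, s) = (X * L l * Y) $$ (r, s)"
      using rs by (simp add: gram_def mult_ac)
  qed (auto simp: gram_def X_def Y_def)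
  then have "det (gram D e l B) = det X * det (L l) * det Y" for l
    using det_mult[OF mult_carrier_mat[OF X L] Y, of l] det_mult[OF X L, of l] by simp
  then have 1: "det (gram D e l B) = of_real ((\<Prod>i\<in>B. l i) * (cmod (det X))\<^sup>2)" for l
    unfolding dL dY using complex_norm_square[of "det X"] by (simp add: mult_ac)
  \<comment> \<open>A kernel vector of the transpose is a combination of the functions that vanishes
    on all of \<open>B\<close>.\<close>
  have 2: "det X \<noteq> 0" if ind: "indep_on B {..<D} e"
  proof
    assume "det X = 0"
    then have "det (transpose_mat X) = 0" using det_transpose[OF X] by simp
    then obtain v where v: "v \<in> carrier_vec D" "v \<noteq> 0\<^sub>v D" "transpose_mat X *\<^sub>v v = 0\<^sub>v D"
      using det_0_iff_vec_prod_zero_field[of "transpose_mat X" D] X by auto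
    have "(\<Sum>a<D. v $ a * e a i) = 0" if i: "i \<in> B" for i
    proof -
      obtain b where b: "b < D" "i = h b" using h i by (auto simp: bij_betw_def)
      have "(transpose_mat X *\<^sub>v v) $ b = (\<Sum>a<D. e a (h b) * v $ a)"
        using b v(1) by (simp add: X_def scalar_prod_def atLeast0LessThan)
      then show ?thesis using v(3) b by (simp add: mult.commute)
    qed
    then have "\<forall>a<D. v $ a = 0" using ind unfolding indep_on_def by blast
    then have "v = 0\<^sub>v D" using v(1) by (intro eq_vecI) auto
    with v(2) show False by blast
  qed
  show ?thesis by (rule that[OF 1 2])
qed

text \<open>With \<open>H\<close> the inverse of the Gram matrix \<open>S\<close>, the kernel
  \<open>Q\<close> is the Gram matrix of the points in the inner product given by \<open>H\<close>.
  The diagonal formula is \<open>H * S * H = H\<close>, the sum equal to \<open>D\<close> is the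
  trace of \<open>H * S\<close>, and the last identity is the rank-one update. The factorisation
  through \<open>g\<close> transports linear relations among the points to \<open>Q\<close>.\<close>

lemma gram_kernel:
  assumes det: "det (gram D e l I) \<noteq> 0"
  obtains Q g where
    "\<And>i j. Q i j = (\<Sum>s<D. g i s * e s j)"
    "\<And>i j. Q i j = cnj (Q j i)"
    "\<And>i. Q i i = of_real (\<Sum>j\<in>I. l j * (cmod (Q i j))\<^sup>2)"
    "(\<Sum>i\<in>I. of_real (l i) * Q i i) = of_nat D"
    "\<And>i t. det (gram D e l I + mat D D (\<lambda>(r, s). of_real t * e r i * cnj (e s i))) =
       det (gram D e l I) * (1 + of_real t * Q i i)"
proof -
  define S where "S = gram D e l I"
  have S: "S \<in> carrier_mat D D" by (simp add: S_def)
  obtain H where H: "H \<in> carrier_mat D D" "H * S = 1\<^sub>m D" "S * H = 1\<^sub>m D"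
    using det_non_zero_imp_unit[OF S, of "()"] det
    unfolding Units_def ring_mat_def S_def by auto
  have HS: "(\<Sum>k<D. H $$ (r, k) * S $$ (k, s)) = (if r = s then 1 else 0)" if "r < D" "s < D" for r s
    using arg_cong[OF H(2), of "\<lambda>M. M $$ (r, s)"] that H(1) S by (simp add: scalar_prod_def atLeast0LessThan)
  have SH: "(\<Sum>k<D. S $$ (r, k) * H $$ (k, s)) = (if r = s then 1 else 0)" if "r < D" "s < D" for r s
    using arg_cong[OF H(3), of "\<lambda>M. M $$ (r, s)"] that H(1) S by (simp add: scalar_prod_def atLeast0LessThan)
  \<comment> \<open>The adjoint of \<open>H\<close> is also a left inverse of the Hermitian
    \<open>S\<close>, hence equal to \<open>H\<close>.\<close>
  define K where "K = mat D D (\<lambda>(r, s). cnj (H $$ (s, r)))"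
  have K: "K \<in> carrier_mat D D" by (simp add: K_def)
  have "K * S = 1\<^sub>m D"
  proof (rule eq_matI)
    fix r s assume "r < dim_row (1\<^sub>m D :: complex mat)" "s < dim_col (1\<^sub>m D :: complex mat)"
    then have rs: "r < D" "s < D" by auto
    have "(K * S) $$ (r, s) = (\<Sum>k<D. cnj (H $$ (k, r)) * S $$ (k, s))"
      using rs S by (simp add: K_def scalar_prod_def atLeast0LessThan)
    also have "\<dots> = cnj (\<Sum>k<D. S $$ (s, k) * H $$ (k, r))"
      using rs by (simp add: S_def gram_hermitian mult.commute)
    also have "\<dots> = (if r = s then 1 else 0)" using SH[OF rs(2,1)] by auto
    finally show "(K * S) $$ (r, s) = 1\<^sub>m D $$ (r, s)" using rs by simp
  qed (use S in \<open>auto simp: K_def\<close>)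
  then have "K = H"
    using assoc_mult_mat[OF K S H(1)] H K by simp
  then have Hh: "cnj (H $$ (s, r)) = H $$ (r, s)" if "r < D" "s < D" for r s
    using that by (metis K_def index_mat(1) old.prod.case)
  define g where "g i s = (\<Sum>r<D. cnj (e r i) * H $$ (r, s))" for i s
  define Q where "Q i j = (\<Sum>s<D. g i s * e s j)" for i j
  have Q2: "Q i j = (\<Sum>r<D. \<Sum>s<D. cnj (e r i) * H $$ (r, s) * e s j)" for i j
    unfolding Q_def g_def sum_distrib_right by (rule sum.swap)
  have herm: "Q i j = cnj (Q j i)" for i j
  proof -
    have "cnj (Q j i) = (\<Sum>r<D. \<Sum>s<D. e r j * H $$ (s, r) * cnj (e s i))"
      unfolding Q2 by (simp add: Hh)
    also have "\<dots> = (\<Sum>s<D. \<Sum>r<D. e r j * H $$ (s, r) * cnj (e s i))" by (rule sum.swap)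
    finally show ?thesis unfolding Q2 by (simp add: mult_ac)
  qed
  have gS: "(\<Sum>s<D. g i s * S $$ (s, p)) = cnj (e p i)" if "p < D" for i p
  proof -
    have "(\<Sum>s<D. g i s * S $$ (s, p)) = (\<Sum>s<D. \<Sum>r<D. cnj (e r i) * (H $$ (r, s) * S $$ (s, p)))"
      by (simp add: g_def sum_distrib_right mult.assoc)
    also have "\<dots> = (\<Sum>r<D. \<Sum>s<D. cnj (e r i) * (H $$ (r, s) * S $$ (s, p)))" by (rule sum.swap)
    also have "\<dots> = (\<Sum>r<D. cnj (e r i) * (if r = p then 1 else 0))"
      using that by (simp add: sum_distrib_left[symmetric] HS)
    finally show ?thesis using that by (simp add: if_distrib sum.delta cong: if_cong)
  qed
  have Sdef: "S $$ (r, s) = (\<Sum>i\<in>I. of_real (l i) * e r i * cnj (e s i))" if "r < D" "s < D" for r s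
    using that by (simp add: S_def gram_def)
  have rep: "Q i i = of_real (\<Sum>j\<in>I. l j * (cmod (Q i j))\<^sup>2)" for i
  proof -
    have "complex_of_real (\<Sum>j\<in>I. l j * (cmod (Q i j))\<^sup>2) = (\<Sum>j\<in>I. of_real (l j) * (Q i j * cnj (Q i j)))"
      by (simp add: complex_norm_square[symmetric])
    also have "\<dots> = (\<Sum>j\<in>I. \<Sum>p<D. \<Sum>s<D. cnj (g i p) * (g i s * (of_real (l j) * e s j * cnj (e p j))))"
      unfolding Q_def by (simp add: sum_distrib_left sum_distrib_right mult_ac)
    also have "\<dots> = (\<Sum>p<D. \<Sum>j\<in>I. \<Sum>s<D. cnj (g i p) * (g i s * (of_real (l j) * e s j * cnj (e p j))))"
      by (rule sum.swap)
    also have "\<dots> = (\<Sum>p<D. \<Sum>s<D. \<Sum>j\<in>I. cnj (g i p) * (g i s * (of_real (l j) * e s j * cnj (e p j))))"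
      by (intro sum.cong refl sum.swap)
    also have "\<dots> = (\<Sum>p<D. cnj (g i p) * (\<Sum>s<D. g i s * S $$ (s, p)))"
      by (simp add: sum_distrib_left Sdef)
    also have "\<dots> = (\<Sum>p<D. cnj (g i p) * cnj (e p i))"
      by (intro sum.cong) (auto simp: gS)
    also have "\<dots> = cnj (Q i i)" by (simp add: Q_def)
    finally show ?thesis using herm[of i i] by simp
  qed
  have "(\<Sum>i\<in>I. of_real (l i) * Q i i) =
      (\<Sum>i\<in>I. \<Sum>r<D. \<Sum>s<D. H $$ (r, s) * (of_real (l i) * e s i * cnj (e r i)))"
    unfolding Q2 by (simp add: sum_distrib_left mult_ac)
  also have "\<dots> = (\<Sum>r<D. \<Sum>i\<in>I. \<Sum>s<D. H $$ (r, s) * (of_real (l i) * e s i * cnj (e r i)))"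
    by (rule sum.swap)
  also have "\<dots> = (\<Sum>r<D. \<Sum>s<D. \<Sum>i\<in>I. H $$ (r, s) * (of_real (l i) * e s i * cnj (e r i)))"
    by (intro sum.cong refl sum.swap)
  also have "\<dots> = (\<Sum>r<D. \<Sum>s<D. H $$ (r, s) * S $$ (s, r))"
    by (simp add: sum_distrib_left Sdef)
  also have "\<dots> = of_nat D" by (simp add: HS)
  finally have tr: "(\<Sum>i\<in>I. of_real (l i) * Q i i) = of_nat D" .
  have upd: "det (gram D e l I + mat D D (\<lambda>(r, s). of_real t * e r i * cnj (e s i))) =
       det (gram D e l I) * (1 + of_real t * Q i i)" for i t
    using det_rank_one_update[OF S H(1,2), of "\<lambda>r. of_real t * e r i" "\<lambda>s. cnj (e s i)"]
    unfolding S_def Q2 by (simp add: sum_distrib_left mult_ac)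
  show ?thesis by (rule that[OF Q_def herm rep tr upd])
qed

text \<open>Points are added one at a time; each multiplies the determinant by
  \<open>1 + l i * q\<close> with \<open>q \<ge> 0\<close>. Positivity of \<open>b\<close> keeps the
  intermediate matrices invertible, as \<open>gram_kernel\<close> demands.\<close>

lemma det_gram_mono:
  assumes "finite I" "B \<subseteq> I" "\<And>i. 0 \<le> l i" "det (gram D e l B) = of_real b" "0 < b"
  shows "\<exists>x\<ge>b. det (gram D e l I) = of_real x"
proof -
  have "\<exists>x\<ge>b. det (gram D e l (B \<union> F)) = of_real x" if "finite F" "B \<inter> F = {}" for F
    using that
  proof (induction F rule: finite_induct)
    case empty
    then show ?case using assms by auto
  next
    case (insert i F)
    then obtain x where x: "x \<ge> b" "det (gram D e l (B \<union> F)) = of_real x" by auto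
    with assms(5) have "det (gram D e l (B \<union> F)) \<noteq> 0" by auto
    then obtain Q g where
      Q: "\<And>i. Q i i = of_real (\<Sum>j\<in>B \<union> F. l j * (cmod (Q i j))\<^sup>2)"
       "\<And>i t. det (gram D e l (B \<union> F) + mat D D (\<lambda>(r, s). of_real t * e r i * cnj (e s i))) =
       det (gram D e l (B \<union> F)) * (1 + of_real t * Q i i)"
      by (rule gram_kernel) blast
    define q where "q = (\<Sum>j\<in>B \<union> F. l j * (cmod (Q i j))\<^sup>2)"
    have q: "q \<ge> 0" unfolding q_def using assms(3) by (intro sum_nonneg) auto
    have "finite (B \<union> F)" "i \<notin> B \<union> F" using insert assms finite_subset[of B I] by auto
    then have "det (gram D e l (insert i (B \<union> F))) = of_real x * (1 + of_real (l i) * of_real q)"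
      using Q x(2) by (simp add: gram_insert q_def)
    then have "det (gram D e l (B \<union> insert i F)) = of_real (x * (1 + l i * q))" by simp
    moreover have "x * 1 \<le> x * (1 + l i * q)"
      using q assms(3)[of i] x(1) assms(5) by (intro mult_left_mono) auto
    ultimately show ?case using x(1) by (intro exI[of _ "x * (1 + l i * q)"]) auto
  qed
  from this[of "I - B"] show ?thesis using assms(1,2) by (simp add: Un_absorb1)
qed

text \<open>From \<open>exp 1 < 4\<close> follows \<open>ln 2 > 1 / 2\<close>. The strict gap is the
  slack that allows a near-minimizer instead of a minimizer below.\<close>

lemma one_plus_half_less_two_powr: "0 < c \<Longrightarrow> 1 + c / 2 < 2 powr (c :: real)"
proof -
  assume c: "0 < c"
  have "exp 1 < (4 :: real)" using exp_le by linarith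
  then have "1 < ln (4 :: real)" using ln_less_cancel_iff[of "exp 1" 4] by simp
  moreover have "ln (4 :: real) = 2 * ln 2" using ln_realpow[of 2 2] by simp
  ultimately have "c / 2 < c * ln 2" using c by (simp add: field_simps)
  moreover have "1 + c * ln 2 \<le> 2 powr c"
    using exp_ge_add_one_self[of "c * ln 2"] by (simp add: powr_def mult.commute)
  ultimately show ?thesis by linarith
qed

text \<open>The point configuration \<open>i \<mapsto> (e 0 i, \<dots>, e (D - 1) i)\<close> is brought close to radial isotropic
  position: every weighted diagonal entry of the reproducing kernel \<open>Q\<close> is at least half of their
  average when \<open>c = D / card I\<close>. The weights are a near-minimizer of \<open>det (gram D e l I) / (\<Prod>i\<in>I. l i) powr c\<close> among powers of
  \<open>2\<close>, as this quotient cannot decrease much when one weight is doubled.\<close>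

lemma near_isotropic_weights:
  fixes e :: "nat \<Rightarrow> 'i \<Rightarrow> complex"
  assumes I: "finite I" and c: "0 < c"
    and heavy: "\<And>w :: 'i \<Rightarrow> real. \<exists>B\<subseteq>I. card B = D \<and> indep_on B {..<D} e \<and>
      c * (\<Sum>i\<in>I. w i) \<le> (\<Sum>i\<in>B. w i)"
  obtains l Q g where
    "\<And>i. 0 < l i"
    "\<And>i j. Q i j = (\<Sum>s<D. g i s * e s j)"
    "\<And>i j. Q i j = cnj (Q j i)"
    "(\<Sum>i\<in>I. \<Sum>j\<in>I. l i * l j * (cmod (Q i j))\<^sup>2) = D"
    "\<And>i. i \<in> I \<Longrightarrow> c / 2 \<le> l i * cmod (Q i i)"
proof -
  define \<B> where "\<B> = {B. B \<subseteq> I \<and> card B = D \<and> indep_on B {..<D} e}"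
  have \<B>: "finite \<B>" "\<B> \<noteq> {}" using I heavy[of "\<lambda>_. 0"] by (auto simp: \<B>_def)
  have "\<exists>z. (\<forall>l. det (gram D e l B) = of_real ((\<Prod>i\<in>B. l i) * (cmod z)\<^sup>2)) \<and> z \<noteq> 0"
    if "B \<in> \<B>" for B
  proof -
    have B: "finite B" "card B = D" "indep_on B {..<D} e"
      using that I finite_subset by (auto simp: \<B>_def)
    from det_gram_card[OF B(1,2), of e] show ?thesis using B(3) by metis
  qed
  then obtain z where z: "\<And>B l. B \<in> \<B> \<Longrightarrow> det (gram D e l B) = of_real ((\<Prod>i\<in>B. l i) * (cmod (z B))\<^sup>2)"
      "\<And>B. B \<in> \<B> \<Longrightarrow> z B \<noteq> 0"
    by metis
  \<comment> \<open>There are finitely many bases \<open>B\<close>, so the squared determinants have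
    a positive lower bound independent of the weights.\<close>
  define \<kappa> where "\<kappa> = Min ((\<lambda>B. (cmod (z B))\<^sup>2) ` \<B>)"
  have \<kappa>: "\<kappa> > 0" "\<And>B. B \<in> \<B> \<Longrightarrow> \<kappa> \<le> (cmod (z B))\<^sup>2"
    using \<B> z(2) unfolding \<kappa>_def by auto
  define l where "l a i = (2 :: real) ^ a i" for a :: "'i \<Rightarrow> nat" and i
  define s where "s a = c * (\<Sum>i\<in>I. real (a i))" for a :: "'i \<Rightarrow> nat"
  \<comment> \<open>A basis that is heavy for the exponents \<open>a\<close> already has a
    determinant this large. Here \<open>2 powr s a\<close> is the product of all weights raised to
    the power \<open>c\<close>.\<close>
  have det: "\<exists>x \<ge> \<kappa> * 2 powr s a. det (gram D e (l a) I) = of_real x" for a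
  proof -
    obtain B where B: "B \<in> \<B>" "s a \<le> (\<Sum>i\<in>B. real (a i))"
      using heavy[of "\<lambda>i. real (a i)"] by (auto simp: \<B>_def s_def)
    then have BI: "B \<subseteq> I" "finite B" using I finite_subset by (auto simp: \<B>_def)
    have "(\<Prod>i\<in>B. l a i) = 2 powr (\<Sum>i\<in>B. real (a i))"
      by (simp add: l_def powr_sum powr_realpow)
    then have "2 powr s a \<le> (\<Prod>i\<in>B. l a i)" using B(2) by simp
    then have "\<kappa> * 2 powr s a \<le> (\<Prod>i\<in>B. l a i) * (cmod (z B))\<^sup>2"
      using \<kappa>(1) \<kappa>(2)[OF B(1)] by (subst mult.commute) (intro mult_mono, auto)
    moreover have "0 < \<kappa> * 2 powr s a" using \<kappa> by simp
    ultimately show ?thesis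
      using det_gram_mono[OF I BI(1) _ z(1)[OF B(1)], of "l a"]
      by (metis (no_types, opaque_lifting) l_def less_le_trans order_trans zero_le_numeral zero_le_power)
  qed
  define \<Phi> where "\<Phi> a = Re (det (gram D e (l a) I)) / 2 powr s a" for a
  have \<Phi>: "\<kappa> \<le> \<Phi> a" for a
    using det[of a] by (auto simp: \<Phi>_def field_simps)
  define \<iota> where "\<iota> = Inf (range \<Phi>)"
  have \<iota>: "\<kappa> \<le> \<iota>" "\<And>a. \<iota> \<le> \<Phi> a"
    unfolding \<iota>_def using \<Phi> by (auto intro!: cInf_greatest cInf_lower bdd_belowI[of _ \<kappa>])
  \<comment> \<open>The infimum of \<open>\<Phi>\<close> over all exponents need not be attained;
    being within the factor \<open>\<rho> > 1\<close> of it suffices.\<close>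
  define \<rho> where "\<rho> = 2 powr c / (1 + c / 2)"
  have \<rho>: "1 < \<rho>" using one_plus_half_less_two_powr[OF c] c by (simp add: \<rho>_def)
  then have "\<iota> < \<iota> * \<rho>" using \<iota>(1) \<kappa>(1) by simp
  then obtain a where a: "\<Phi> a < \<iota> * \<rho>"
    using cInf_lessD[of "range \<Phi>" "\<iota> * \<rho>"] by (auto simp: \<iota>_def)
  obtain x where x: "\<kappa> * 2 powr s a \<le> x" "det (gram D e (l a) I) = of_real x" using det by blast
  moreover have "0 < \<kappa> * 2 powr s a" using \<kappa> by simp
  ultimately have x0: "0 < x" "det (gram D e (l a) I) \<noteq> 0" by auto
  obtain Q g where
    Q: "\<And>i j. Q i j = (\<Sum>s<D. g i s * e s j)" "\<And>i j. Q i j = cnj (Q j i)"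
     "\<And>i. Q i i = of_real (\<Sum>j\<in>I. l a j * (cmod (Q i j))\<^sup>2)"
     "(\<Sum>i\<in>I. of_real (l a i) * Q i i) = of_nat D"
     "\<And>i t. det (gram D e (l a) I + mat D D (\<lambda>(r, s). of_real t * e r i * cnj (e s i))) =
       det (gram D e (l a) I) * (1 + of_real t * Q i i)"
    by (rule gram_kernel[OF x0(2)]) blast
  define q where "q i = (\<Sum>j\<in>I. l a j * (cmod (Q i j))\<^sup>2)" for i
  have q: "Q i i = of_real (q i)" "0 \<le> q i" for i
    using Q(3) by (auto simp: q_def l_def intro!: sum_nonneg)
  have "complex_of_real (\<Sum>i\<in>I. l a i * q i) = of_real (real D)"
    using Q(4) unfolding q by simp
  then have "(\<Sum>i\<in>I. l a i * q i) = real D" by (simp only: of_real_eq_iff)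
  then have tr: "(\<Sum>i\<in>I. \<Sum>j\<in>I. l a i * l a j * (cmod (Q i j))\<^sup>2) = D"
    by (simp add: q_def sum_distrib_left mult_ac)
  have "c / 2 \<le> l a i * cmod (Q i i)" if i: "i \<in> I" for i
  proof -
    define a' where "a' = a(i := Suc (a i))"
    have la: "l a' = (l a)(i := 2 * l a i)" by (auto simp: l_def a'_def)
    have "det (gram D e (l a') I) = of_real x * (1 + of_real (l a i) * of_real (q i))"
      unfolding la gram_double[OF I i] Q(5) x(2) q ..
    then have "det (gram D e (l a') I) = of_real (x * (1 + l a i * q i))" by simp
    moreover have "s a' = s a + c"
      using I i by (simp add: s_def a'_def sum.remove algebra_simps)
    \<comment> \<open>Doubling one weight is a rank-one update of the numerator and multiplies the
      denominator by \<open>2 powr c\<close>. As \<open>\<Phi> a'\<close> is not below the infimum,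
      \<open>1 + l a i * q i\<close> must exceed
      \<open>2 powr c / \<rho> = 1 + c / 2\<close>.\<close>
    ultimately have "\<Phi> a' = \<Phi> a * (1 + l a i * q i) / 2 powr c"
      by (simp add: \<Phi>_def x(2) powr_add)
    moreover have "\<Phi> a / \<rho> < \<Phi> a'"
      using a \<iota>(2)[of a'] \<rho> by (simp add: field_simps) (smt (verit) mult_right_mono mult.commute)
    ultimately have "\<Phi> a * (1 + c / 2) < \<Phi> a * (1 + l a i * q i)"
      using c by (simp add: \<rho>_def field_simps)
    then show ?thesis using q[of i] \<Phi>[of a] \<kappa>(1) by (simp add: mult_less_cancel_left_pos)
  qed
  then show ?thesis by (intro that[OF _ Q(1,2) tr]) (auto simp: l_def)
qed

section \<open>Dimension bound for systems of triples\<close>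

text \<open>Three vectors with a linear relation span at most a plane, so they cannot be nearly pairwise
  orthogonal. Pairing the relation with the vector of largest coefficient makes this quantitative.\<close>

lemma dependent_triple_aux:
  fixes Q :: "'i \<Rightarrow> 'i \<Rightarrow> complex" and l :: "'i \<Rightarrow> real"
  assumes l: "\<And>i. 0 < l i" and h: "0 < h"
    and big: "\<And>i. i \<in> I \<Longrightarrow> h \<le> l i * cmod (Q i i)" and out: "\<And>i j. j \<notin> I \<Longrightarrow> Q i j = 0"
    and dep: "a * Q i i + b * Q i j + c * Q i k = 0"
    and max: "(cmod b)\<^sup>2 * cmod (Q j j) \<le> (cmod a)\<^sup>2 * cmod (Q i i)"
      "(cmod c)\<^sup>2 * cmod (Q k k) \<le> (cmod a)\<^sup>2 * cmod (Q i i)"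
    and i: "i \<in> I" and a: "a \<noteq> 0"
  shows "h\<^sup>2 / 2 \<le> l i * l j * (cmod (Q i j))\<^sup>2 + l i * l k * (cmod (Q i k))\<^sup>2"
proof -
  define q where "q = cmod (Q i i)"
  have q: "0 < q" "h \<le> l i * q"
    using big[OF i] l[of i] h by (auto simp: q_def zero_less_mult_iff intro: ccontr)
  \<comment> \<open>The lower bound on \<open>l j * cmod (Q j j)\<close> trades \<open>h\<close> for
    the weight \<open>l j\<close>, and maximality of the term at \<open>i\<close> removes
    \<open>b\<close>. Outside \<open>I\<close> both sides are 0.\<close>
  have *: "(cmod b)\<^sup>2 * (cmod (Q i j))\<^sup>2 * h \<le> (cmod a)\<^sup>2 * q * (l j * (cmod (Q i j))\<^sup>2)"
    if "(cmod b)\<^sup>2 * cmod (Q j j) \<le> (cmod a)\<^sup>2 * q" for b j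
  proof (cases "j \<in> I")
    case True
    have "(cmod b)\<^sup>2 * (cmod (Q i j))\<^sup>2 * h \<le> (cmod b)\<^sup>2 * (cmod (Q i j))\<^sup>2 * (l j * cmod (Q j j))"
      using big[OF True] by (intro mult_left_mono) auto
    also have "\<dots> = ((cmod b)\<^sup>2 * cmod (Q j j)) * (l j * (cmod (Q i j))\<^sup>2)" by simp
    also have "\<dots> \<le> ((cmod a)\<^sup>2 * q) * (l j * (cmod (Q i j))\<^sup>2)"
      using that l[of j] by (intro mult_right_mono) auto
    finally show ?thesis .
  qed (simp add: out)
  have "cmod a * q \<le> cmod b * cmod (Q i j) + cmod c * cmod (Q i k)"
  proof -
    have "a * Q i i = - (b * Q i j + c * Q i k)" using dep by (simp add: add_eq_0_iff2 add.assoc)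
    then have "cmod a * q = cmod (b * Q i j + c * Q i k)"
      by (metis norm_minus_cancel norm_mult q_def)
    also have "\<dots> \<le> cmod b * cmod (Q i j) + cmod c * cmod (Q i k)"
      by (metis norm_mult norm_triangle_ineq)
    finally show ?thesis .
  qed
  then have "(cmod a * q)\<^sup>2 \<le> (cmod b * cmod (Q i j) + cmod c * cmod (Q i k))\<^sup>2"
    using q by (intro power_mono) auto
  also have "\<dots> \<le> 2 * ((cmod b)\<^sup>2 * (cmod (Q i j))\<^sup>2 + (cmod c)\<^sup>2 * (cmod (Q i k))\<^sup>2)"
    using sum_squares_ge_zero[of "cmod b * cmod (Q i j) - cmod c * cmod (Q i k)" 0]
    by (simp add: power2_eq_square algebra_simps)
  finally have "(cmod a * q)\<^sup>2 * h \<le>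
      2 * ((cmod b)\<^sup>2 * (cmod (Q i j))\<^sup>2 + (cmod c)\<^sup>2 * (cmod (Q i k))\<^sup>2) * h"
    using h by (intro mult_right_mono) auto
  also have "\<dots> = 2 * ((cmod b)\<^sup>2 * (cmod (Q i j))\<^sup>2 * h + (cmod c)\<^sup>2 * (cmod (Q i k))\<^sup>2 * h)"
    by (simp add: algebra_simps)
  also have "\<dots> \<le> 2 * ((cmod a)\<^sup>2 * q * (l j * (cmod (Q i j))\<^sup>2) + (cmod a)\<^sup>2 * q * (l k * (cmod (Q i k))\<^sup>2))"
    using *[OF max(1)[folded q_def]] *[OF max(2)[folded q_def]] by (intro mult_left_mono add_mono) auto
  finally have "((cmod a)\<^sup>2 * q) * (q * h) \<le>
      ((cmod a)\<^sup>2 * q) * (2 * (l j * (cmod (Q i j))\<^sup>2 + l k * (cmod (Q i k))\<^sup>2))"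
    by (simp add: power2_eq_square algebra_simps)
  then have "q * h \<le> 2 * (l j * (cmod (Q i j))\<^sup>2 + l k * (cmod (Q i k))\<^sup>2)"
    using q a by (subst (asm) mult_le_cancel_left_pos) auto
  then have "l i * (q * h) \<le> l i * (2 * (l j * (cmod (Q i j))\<^sup>2 + l k * (cmod (Q i k))\<^sup>2))"
    using l[of i] by (intro mult_left_mono) auto
  moreover have "h * h \<le> l i * q * h" using q(2) h by (intro mult_right_mono) auto
  ultimately show ?thesis by (simp add: power2_eq_square algebra_simps)
qed

text \<open>Symmetry allows the largest term of the relation to play the role of the first one in
  \<open>dependent_triple_aux\<close>; the third product is only discarded.\<close>

lemma dependent_triple:
  fixes Q :: "'i \<Rightarrow> 'i \<Rightarrow> complex" and l :: "'i \<Rightarrow> real"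
  assumes l: "\<And>i. 0 < l i" and h: "0 < h"
    and big: "\<And>i. i \<in> I \<Longrightarrow> h \<le> l i * cmod (Q i i)" and out: "\<And>i j. j \<notin> I \<Longrightarrow> Q i j = 0"
    and herm: "\<And>i j. Q i j = cnj (Q j i)"
    and dep: "\<And>r. a * Q r i + b * Q r j + c * Q r k = 0"
    and nz: "a \<noteq> 0" "b \<noteq> 0" "c \<noteq> 0" and i: "i \<in> I"
  shows "h\<^sup>2 / 2 \<le> l i * l j * (cmod (Q i j))\<^sup>2 + l j * l k * (cmod (Q j k))\<^sup>2
    + l i * l k * (cmod (Q i k))\<^sup>2"
proof -
  define \<mu> where "\<mu> x i = (cmod x)\<^sup>2 * cmod (Q i i)" for x i
  have "0 < l i * cmod (Q i i)" using big[OF i] h by linarith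
  then have \<mu>i: "0 < \<mu> a i" using l[of i] nz by (simp add: \<mu>_def zero_less_mult_iff)
  \<comment> \<open>Only \<open>i\<close> is known to lie in \<open>I\<close>, but the largest term
    is at least \<open>\<mu> a i > 0\<close>, so its point lies in \<open>I\<close> too.\<close>
  have in_I: "r \<in> I" if "0 < \<mu> x r" for x r
    using that out[of r r] by (cases "r \<in> I") (simp_all add: \<mu>_def)
  have sym: "cmod (Q r s) = cmod (Q s r)" for r s using herm by (metis complex_mod_cnj)
  have nn: "0 \<le> l r * l s * (cmod (Q r s))\<^sup>2" for r s
    using l[of r] l[of s] by simp
  have aux: "h\<^sup>2 / 2 \<le> l i * l j * (cmod (Q i j))\<^sup>2 + l i * l k * (cmod (Q i k))\<^sup>2"
    if "a * Q i i + b * Q i j + c * Q i k = 0" "\<mu> b j \<le> \<mu> a i" "\<mu> c k \<le> \<mu> a i" "i \<in> I" "a \<noteq> 0"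
    for a b c i j k
    using that l h big out unfolding \<mu>_def
    by (intro dependent_triple_aux[of l h I Q a i b j c k]) blast+
  consider "\<mu> b j \<le> \<mu> a i" "\<mu> c k \<le> \<mu> a i" | "\<mu> a i \<le> \<mu> b j" "\<mu> c k \<le> \<mu> b j"
    | "\<mu> a i \<le> \<mu> c k" "\<mu> b j \<le> \<mu> c k" by linarith
  then show ?thesis
  proof cases
    case 1
    show ?thesis using aux[OF dep 1 i nz(1)] nn[of j k] by linarith
  next
    case 2
    have "j \<in> I" using in_I[of b j] \<mu>i 2 by linarith
    moreover have "b * Q j j + a * Q j i + c * Q j k = 0" using dep[of j] by (simp add: add_ac)
    ultimately show ?thesis using aux[of b j a i c k] 2 nn[of i k] nz sym[of i j]
      by (simp add: mult.commute[of "l j" "l i"])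
  next
    case 3
    have "k \<in> I" using in_I[of c k] \<mu>i 3 by linarith
    moreover have "c * Q k k + a * Q k i + b * Q k j = 0" using dep[of k] by (simp add: add_ac)
    ultimately show ?thesis using aux[of c k a i b j] 3 nn[of i j] nz sym[of i k] sym[of j k]
      by (simp add: mult.commute[of "l k"])
  qed
qed

text \<open>Double counting of the entries \<open>m i j\<close>, whose total is \<open>D\<close>. By
  \<open>dependent_triple\<close>, the triples starting in \<open>I\<close> contribute at least
  \<open>N * K * h^2 / 2\<close>. Each pair has total weight at most 1 in each of the three
  positions, so the contribution is at most \<open>3 * D\<close>. Inserting
  \<open>h = D / N / 2\<close> gives the constant 24.\<close>

lemma design_bound_of_slope:
  fixes e :: "nat \<Rightarrow> 'i \<Rightarrow> complex" and w :: "'i \<Rightarrow> 'i \<Rightarrow> 'i \<Rightarrow> real"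
  assumes V: "finite V" and IV: "I \<subseteq> V" and D: "0 < D"
    and out: "\<And>s i. s < D \<Longrightarrow> i \<in> V - I \<Longrightarrow> e s i = 0"
    and heavy: "\<And>u :: 'i \<Rightarrow> real. \<exists>B\<subseteq>I. card B = D \<and> indep_on B {..<D} e \<and>
      (real D / card I) * (\<Sum>i\<in>I. u i) \<le> (\<Sum>i\<in>B. u i)"
    and I: "card I > 0"
    and w: "\<And>i j k. 0 \<le> w i j k" "\<And>i j k. w i j k = w j i k" "\<And>i j k. w i j k = w i k j"
    and pair: "\<And>i j. i \<in> V \<Longrightarrow> j \<in> V \<Longrightarrow> (\<Sum>k\<in>V. w i j k) \<le> 1"
    and deg: "\<And>i. i \<in> V \<Longrightarrow> K \<le> (\<Sum>j\<in>V. \<Sum>k\<in>V. w i j k)"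
    and dep: "\<And>i j k. w i j k \<noteq> 0 \<Longrightarrow> i \<in> V \<Longrightarrow> j \<in> V \<Longrightarrow> k \<in> V \<Longrightarrow>
      \<exists>a b c. a \<noteq> 0 \<and> b \<noteq> 0 \<and> c \<noteq> 0 \<and> (\<forall>s<D. a * e s i + b * e s j + c * e s k = 0)"
  shows "real D * K \<le> 24 * real (card I)"
proof -
  define N where "N = real (card I)"
  define h where "h = real D / N / 2"
  have h: "0 < h" using D I by (simp add: h_def N_def)
  have fI: "finite I" using V IV finite_subset by blast
  \<comment> \<open>The hypothesis \<open>out\<close> covers \<open>V - I\<close> only; truncation
    makes the kernel vanish at every point outside \<open>I\<close>.\<close>
  define e' where "e' s i = (if i \<in> I then e s i else 0)" for s i
  have heavy': "\<exists>B\<subseteq>I. card B = D \<and> indep_on B {..<D} e' \<and>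
      (real D / card I) * (\<Sum>i\<in>I. u i) \<le> (\<Sum>i\<in>B. u i)" for u :: "'i \<Rightarrow> real"
  proof -
    obtain B where B: "B \<subseteq> I" "card B = D" "indep_on B {..<D} e"
       "(real D / card I) * (\<Sum>i\<in>I. u i) \<le> (\<Sum>i\<in>B. u i)" using heavy by blast
    have "(\<Sum>s<D. x s * e' s i) = (\<Sum>s<D. x s * e s i)" if "i \<in> B" for x i
      using that B(1) by (intro sum.cong) (auto simp: e'_def)
    then have "indep_on B {..<D} e'" using B(3) by (simp add: indep_on_def)
    then show ?thesis using B by blast
  qed
  have c: "0 < real D / card I" using D I by simp
  obtain l Q g where
    l: "\<And>i. 0 < l i" and
    Q: "\<And>i j. Q i j = (\<Sum>s<D. g i s * e' s j)"
    "\<And>i j. Q i j = cnj (Q j i)"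
    "(\<Sum>i\<in>I. \<Sum>j\<in>I. l i * l j * (cmod (Q i j))\<^sup>2) = D"
    "\<And>i. i \<in> I \<Longrightarrow> real D / card I / 2 \<le> l i * cmod (Q i i)"
    by (rule near_isotropic_weights[OF fI c heavy']) blast
  have Q0: "Q i j = 0" if "j \<notin> I" for i j using that by (simp add: Q(1) e'_def)
  have Q0': "Q i j = 0" if "i \<notin> I" for i j using Q0[OF that] Q(2)[of i j] by simp
  define m where "m i j = l i * l j * (cmod (Q i j))\<^sup>2" for i j
  have m: "0 \<le> m i j" "m i j = m j i" for i j
    using l[of i] l[of j] Q(2)[of i j] by (simp_all add: m_def mult_ac)
  have mI: "i \<in> I \<and> j \<in> I" if "m i j \<noteq> 0" for i j
    using that Q0 Q0' by (auto simp: m_def)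
  have sumV: "(\<Sum>i\<in>V. \<Sum>j\<in>V. m i j) = D"
  proof -
    have "(\<Sum>i\<in>V. \<Sum>j\<in>V. m i j) = (\<Sum>i\<in>I. \<Sum>j\<in>V. m i j)"
      using mI V IV by (intro sum.mono_neutral_right) (auto intro!: sum.neutral)
    also have "\<dots> = (\<Sum>i\<in>I. \<Sum>j\<in>I. m i j)"
      using mI V IV by (intro sum.cong refl sum.mono_neutral_right) auto
    finally show ?thesis using Q(3) by (simp add: m_def)
  qed
  have triple: "w i j k * (h\<^sup>2 / 2) \<le> w i j k * (m i j + m j k + m i k)"
    if ijk: "i \<in> I" "j \<in> V" "k \<in> V" for i j k
  proof (cases "w i j k = 0")
    case False
    then obtain a b c where abc: "a \<noteq> 0" "b \<noteq> 0" "c \<noteq> 0"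
      "\<forall>s<D. a * e s i + b * e s j + c * e s k = 0" using dep[of i j k] ijk IV by blast
    have e': "a * e' s i + b * e' s j + c * e' s k = 0" if "s < D" for s
      using abc(4)[rule_format, OF that] out[OF that] ijk IV unfolding e'_def by auto
    have "a * Q r i + b * Q r j + c * Q r k = (\<Sum>s<D. g r s * (a * e' s i + b * e' s j + c * e' s k))" for r
      by (simp add: Q(1) sum_distrib_left sum.distrib algebra_simps)
    then have "a * Q r i + b * Q r j + c * Q r k = 0" for r by (simp add: e')
    then have "h\<^sup>2 / 2 \<le> m i j + m j k + m i k"
      unfolding m_def
      by (intro dependent_triple[OF l h _ Q0 Q(2) _ abc(1-3) ijk(1)]) (use Q(4) in \<open>auto simp: h_def N_def\<close>)
    then show ?thesis using w(1) by (intro mult_left_mono)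
  qed simp
  define T where "T f = (\<Sum>i\<in>V. \<Sum>j\<in>V. \<Sum>k\<in>V. w i j k * f i j k)" for f :: "'i \<Rightarrow> 'i \<Rightarrow> 'i \<Rightarrow> real"
  have T1: "T (\<lambda>i j k. m i j) \<le> D"
  proof -
    have "T (\<lambda>i j k. m i j) = (\<Sum>i\<in>V. \<Sum>j\<in>V. (\<Sum>k\<in>V. w i j k) * m i j)"
      by (simp add: T_def sum_distrib_right)
    also have "\<dots> \<le> (\<Sum>i\<in>V. \<Sum>j\<in>V. 1 * m i j)"
      using pair m(1) by (intro sum_mono mult_right_mono) auto
    finally show ?thesis using sumV by simp
  qed
  have T2: "T (\<lambda>i j k. m i k) = T (\<lambda>i j k. m i j)"
  proof -
    have "T (\<lambda>i j k. m i k) = (\<Sum>i\<in>V. \<Sum>k\<in>V. \<Sum>j\<in>V. w i j k * m i k)"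
      unfolding T_def by (intro sum.cong refl sum.swap)
    also have "\<dots> = T (\<lambda>i j k. m i j)" unfolding T_def by (subst w(3)) (rule refl)
    finally show ?thesis .
  qed
  have T3: "T (\<lambda>i j k. m j k) = T (\<lambda>i j k. m i k)"
  proof -
    have "T (\<lambda>i j k. m j k) = (\<Sum>j\<in>V. \<Sum>i\<in>V. \<Sum>k\<in>V. w i j k * m j k)"
      unfolding T_def by (rule sum.swap)
    also have "\<dots> = T (\<lambda>i j k. m i k)" unfolding T_def by (subst w(2)) (rule refl)
    finally show ?thesis .
  qed
  have "N * K * (h\<^sup>2 / 2) = (\<Sum>i\<in>I. K) * (h\<^sup>2 / 2)" by (simp add: N_def)
  also have "\<dots> \<le> (\<Sum>i\<in>I. \<Sum>j\<in>V. \<Sum>k\<in>V. w i j k) * (h\<^sup>2 / 2)"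
    using deg IV by (intro mult_right_mono sum_mono) auto
  also have "\<dots> = (\<Sum>i\<in>I. \<Sum>j\<in>V. \<Sum>k\<in>V. w i j k * (h\<^sup>2 / 2))"
    by (simp only: sum_distrib_right)
  also have "\<dots> \<le> (\<Sum>i\<in>I. \<Sum>j\<in>V. \<Sum>k\<in>V. w i j k * (m i j + m j k + m i k))"
    using triple by (intro sum_mono) auto
  also have "\<dots> \<le> T (\<lambda>i j k. m i j + m j k + m i k)"
    unfolding T_def using V IV w(1) m(1)
    by (intro sum_mono2) (auto intro!: sum_nonneg mult_nonneg_nonneg add_nonneg_nonneg)
  also have "\<dots> = T (\<lambda>i j k. m i j) + T (\<lambda>i j k. m j k) + T (\<lambda>i j k. m i k)"
    by (simp add: T_def distrib_left sum.distrib)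
  also have "\<dots> \<le> 3 * real D" using T1 T2 T3 by simp
  finally have le: "N * K * ((real D / N / 2)\<^sup>2 / 2) \<le> 3 * real D" unfolding h_def .
  have N: "0 < N" using I by (simp add: N_def)
  have eq: "N * K * ((real D / N / 2)\<^sup>2 / 2) = real D * (real D * K / (8 * N))"
    using N by (simp add: power2_eq_square field_simps)
  have "real D * (real D * K / (8 * N)) \<le> real D * 3"
    using le unfolding eq by (simp only: mult.commute[of 3])
  then have "real D * K / (8 * N) \<le> 3" using D by (subst (asm) mult_le_cancel_left_pos) auto
  then show ?thesis using N by (simp add: field_simps N_def)
qed

text \<open>Passing to a subfamily that maximizes the ratio of dimension to size of the support makes the
  configuration semistable, which is what radial isotropic position requires.\<close>

theorem design_bound:
  fixes e :: "nat \<Rightarrow> 'i \<Rightarrow> complex" and w :: "'i \<Rightarrow> 'i \<Rightarrow> 'i \<Rightarrow> real"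
  assumes V: "finite V" and A: "finite A" "indep_on V A e" "\<And>a. a \<in> A \<Longrightarrow> e a \<in> R"
    and R: "\<And>f g t. f \<in> R \<Longrightarrow> g \<in> R \<Longrightarrow> (\<lambda>i. f i - t * g i) \<in> R"
    and w: "\<And>i j k. 0 \<le> w i j k" "\<And>i j k. w i j k = w j i k" "\<And>i j k. w i j k = w i k j"
    and pair: "\<And>i j. i \<in> V \<Longrightarrow> j \<in> V \<Longrightarrow> (\<Sum>k\<in>V. w i j k) \<le> 1"
    and deg: "\<And>i. i \<in> V \<Longrightarrow> K \<le> (\<Sum>j\<in>V. \<Sum>k\<in>V. w i j k)" and K: "0 < K"
    and dep: "\<And>i j k. w i j k \<noteq> 0 \<Longrightarrow> i \<in> V \<Longrightarrow> j \<in> V \<Longrightarrow> k \<in> V \<Longrightarrow>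
      \<exists>a b c. a \<noteq> 0 \<and> b \<noteq> 0 \<and> c \<noteq> 0 \<and> (\<forall>f\<in>R. a * f i + b * f j + c * f k = 0)"
  shows "real (card A) * K \<le> 24 * real (card V)"
proof (cases "A = {}")
  case False
  define good where "good A e \<longleftrightarrow> finite A \<and> A \<noteq> {} \<and> indep_on V A e \<and> (\<forall>a\<in>A. e a \<in> R)"
    for A :: "nat set" and e :: "nat \<Rightarrow> 'i \<Rightarrow> complex"
  define slope where "slope A e = real (card A) / real (card (supp V A e))"
    for A :: "nat set" and e :: "nat \<Rightarrow> 'i \<Rightarrow> complex"
  have fs: "finite (supp V A e)" "card (supp V A e) \<le> card V" for A and e :: "nat \<Rightarrow> 'i \<Rightarrow> complex"
    using V by (auto simp: supp_def intro!: card_mono)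
  have le: "card A \<le> card (supp V A e)" if "good A e" for A e
    using that card_indep_le[of "supp V A e" A e] fs(1)[of A e] by (simp add: good_def indep_on_supp)
  have pos: "0 < card A" if "good A e" for A and e :: "nat \<Rightarrow> 'i \<Rightarrow> complex"
    using that by (auto simp: good_def card_gt_0_iff)
  \<comment> \<open>Sizes and supports are at most \<open>card V\<close>, so only finitely many
    slopes occur, although there are infinitely many families.\<close>
  define \<F> where "\<F> = {slope A e |A e. good A e}"
  have "finite \<F>"
  proof (rule finite_subset)
    show "\<F> \<subseteq> (\<lambda>(x, y). real x / real y) ` ({..card V} \<times> {..card V})"
    proof
      fix x assume "x \<in> \<F>"
      then obtain A e where "good A e" "x = slope A e" by (auto simp: \<F>_def)
      then show "x \<in> (\<lambda>(x, y). real x / real y) ` ({..card V} \<times> {..card V})"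
        using order_trans[OF le fs(2)] fs(2)
        by (intro image_eqI[of _ _ "(card A, card (supp V A e))"]) (auto simp: slope_def)
    qed
  qed auto
  have gA: "good A e" using A False by (auto simp: good_def)
  then have "\<F> \<noteq> {}" by (auto simp: \<F>_def)
  then have "Max \<F> \<in> \<F>" using \<open>finite \<F>\<close> by (rule Max_in[rotated])
  then obtain A1 e1 where A1: "good A1 e1" and "slope A1 e1 = Max \<F>" by (auto simp: \<F>_def)
  then have A1_max: "slope A e \<le> slope A1 e1" if "good A e" for A e
    using that Max_ge[OF \<open>finite \<F>\<close>] by (auto simp: \<F>_def)
  define D where "D = card A1"
  \<comment> \<open>Relabelling, since Gram matrices index the functions by
    \<open>{..<D}\<close>.\<close>
  obtain h where h: "bij_betw h {..<D} A1"
    using ex_bij_betw_nat_finite[of A1] A1 by (auto simp: good_def D_def atLeast0LessThan)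
  define e2 where "e2 = e1 \<circ> h"
  have "indep_on V {..<D} e2"
    unfolding indep_on_def
  proof (intro allI impI ballI)
    fix c s assume c: "\<forall>i\<in>V. (\<Sum>a<D. c a * e2 a i) = 0" and s: "s \<in> {..<D}"
    define c' where "c' = c \<circ> the_inv_into {..<D} h"
    have inv: "the_inv_into {..<D} h (h a) = a" if "a < D" for a
      using that h by (simp add: bij_betw_def the_inv_into_f_f)
    have "(\<Sum>a\<in>A1. c' a * e1 a i) = (\<Sum>a<D. c a * e2 a i)" for i
      unfolding sum.reindex_bij_betw[OF h, symmetric] by (intro sum.cong) (auto simp: c'_def e2_def inv)
    with c have "\<forall>i\<in>V. (\<Sum>a\<in>A1. c' a * e1 a i) = 0" by simp
    then have "\<forall>a\<in>A1. c' a = 0" using A1 unfolding good_def indep_on_def by blast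
    moreover have "h s \<in> A1" using s h by (auto simp: bij_betw_def)
    ultimately have "c' (h s) = 0" by blast
    then show "c s = 0" using s inv[of s] by (simp add: c'_def)
  qed
  then have g2: "good {..<D} e2"
    using A1 h pos[OF A1] by (auto simp: good_def e2_def D_def bij_betw_def)
  define I where "I = supp V {..<D} e2"
  have D: "0 < D" using pos[OF A1] by (simp add: D_def)
  have cI: "0 < card I" using le[OF g2] D by (simp add: I_def)
  have IV: "I \<subseteq> V" by (auto simp: I_def supp_def)
  have fI: "finite I" using fs by (simp add: I_def)
  have supp2: "supp V A1 e1 = I"
    using h by (auto simp: I_def supp_def e2_def bij_betw_def)
  have max: "real (card A) \<le> real D / card I * card (supp V A e)" if "good A e" for A e
    using A1_max[OF that] le[OF that] pos[OF that]
    by (simp add: slope_def supp2 D_def[symmetric] field_simps)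
  \<comment> \<open>Functions of \<open>R'\<close> extend by zero from \<open>I\<close> to
    \<open>V\<close>: independence on \<open>I\<close> gives independence on \<open>V\<close> with
    the same support, so the maximal slope also bounds families on \<open>I\<close>.\<close>
  define R' where "R' = {f \<in> R. \<forall>i\<in>V - I. f i = 0}"
  have R': "(\<lambda>i. f i - t * g i) \<in> R'" if "f \<in> R'" "g \<in> R'" for f g t
    using that R by (auto simp: R'_def)
  have e2R: "e2 s \<in> R'" if "s \<in> {..<D}" for s
    using that g2 by (auto simp: R'_def good_def I_def supp_def)
  have slope': "real (card A') \<le> real D / card I * card (supp I A' e')"
    if "finite A'" "indep_on I A' e'" "\<And>a. a \<in> A' \<Longrightarrow> e' a \<in> R'" for A' e'
  proof (cases "A' = {}")
    case False
    then have "good A' e'"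
      using that indep_on_mono[OF that(2) IV] by (auto simp: good_def R'_def)
    moreover have "supp V A' e' = supp I A' e'"
      using that(3) IV by (auto simp: supp_def R'_def)
    ultimately show ?thesis using max by metis
  qed simp
  have indI: "indep_on I {..<D} e2" using g2 by (simp add: I_def indep_on_supp good_def)
  have "real D / card I \<ge> 0" by simp
  have weight_le: "u i \<le> Max (u ` I)" if "i \<in> I" for u :: "'i \<Rightarrow> real" and i
    using that fI by simp
  \<comment> \<open>For the maximizing family the error term of \<open>heavy_basis\<close> has the
    factor \<open>D / card I * card I - D = 0\<close>.\<close>
  have heavy: "\<exists>B\<subseteq>I. card B = D \<and> indep_on B {..<D} e2 \<and>
      real D / card I * (\<Sum>i\<in>I. u i) \<le> (\<Sum>i\<in>B. u i)" for u :: "'i \<Rightarrow> real"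
  proof -
    have "\<exists>B\<subseteq>I. card B = card {..<D} \<and> indep_on B {..<D} e2 \<and>
      (\<Sum>i\<in>B. u i) \<ge> real D / card I * (\<Sum>i\<in>I. u i) - (real D / card I * card I - card {..<D}) * Max (u ` I)"
      by (rule heavy_basis[where R = R'])
        (fact fI finite_lessThan indI e2R R' slope' \<open>real D / card I \<ge> 0\<close> weight_le)+
    then show ?thesis using cI by simp
  qed
  have out: "e2 s i = 0" if "s < D" "i \<in> V - I" for s i
    using that by (auto simp: I_def supp_def)
  have dep': "\<exists>a b c. a \<noteq> 0 \<and> b \<noteq> 0 \<and> c \<noteq> 0 \<and> (\<forall>s<D. a * e2 s i + b * e2 s j + c * e2 s k = 0)"
    if ijk: "w i j k \<noteq> 0" "i \<in> V" "j \<in> V" "k \<in> V" for i j k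
  proof -
    obtain a b c where "a \<noteq> 0" "b \<noteq> 0" "c \<noteq> 0" "\<forall>f\<in>R. a * f i + b * f j + c * f k = 0"
      using dep[OF ijk] by blast
    moreover have "e2 s \<in> R" if "s < D" for s using e2R that by (auto simp: R'_def)
    ultimately show ?thesis by blast
  qed
  have "real D * K \<le> 24 * real (card I)"
    by (rule design_bound_of_slope[where e = e2 and w = w])
      (fact V IV D out heavy cI w pair deg dep')+
  \<comment> \<open>The given family has at most the maximal slope \<open>D / card I\<close>, which
    has just been bounded by \<open>24 / K\<close>.\<close>
  moreover have "real (card A) \<le> real D / card I * card V"
  proof -
    have "real (card A) \<le> real D / card I * card (supp V A e)" by (rule max[OF gA])
    also have "\<dots> \<le> real D / card I * card V" using fs by (intro mult_left_mono) auto
    finally show ?thesis .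
  qed
  then have "real (card A) * K \<le> real D / card I * card V * K"
    using K by (intro mult_right_mono) auto
  moreover have "real D / card I * card V * K = (real D * K) * (card V / card I)" by simp
  moreover have "(real D * K) * (card V / card I) \<le> 24 * real (card I) * (card V / card I)"
    using calculation(1) by (intro mult_right_mono) auto
  ultimately show ?thesis using cI by (simp add: mult_ac)
qed simp

section \<open>A subset in which every point carries large weight\<close>

text \<open>For \<open>S\<close> maximizing \<open>g\<close>, removing \<open>i\<close> saves
  \<open>c\<close> and loses at most three times the weight at \<open>i\<close>, once for each
  position in a triple. Hence that weight is at least \<open>c / 3\<close>. Since
  \<open>g V > 0 = g {}\<close>, the maximizer is nonempty.\<close>

lemma heavy_subset:
  fixes w :: "'i \<Rightarrow> 'i \<Rightarrow> 'i \<Rightarrow> real" and c :: real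
  assumes V: "finite V"
    and w: "\<And>i j k. 0 \<le> w i j k" "\<And>i j k. w i j k = w j i k" "\<And>i j k. w i j k = w i k j"
    and c: "c * card V < (\<Sum>i\<in>V. \<Sum>j\<in>V. \<Sum>k\<in>V. w i j k)"
  shows "\<exists>S\<subseteq>V. S \<noteq> {} \<and> (\<forall>i\<in>S. c / 3 \<le> (\<Sum>j\<in>S. \<Sum>k\<in>S. w i j k))"
proof -
  define W where "W S = (\<Sum>i\<in>S. \<Sum>j\<in>S. \<Sum>k\<in>S. w i j k)" for S
  define g where "g S = W S - c * card S" for S
  have "finite (g ` Pow V)" "g ` Pow V \<noteq> {}" using V by auto
  then have "Max (g ` Pow V) \<in> g ` Pow V" by (rule Max_in)
  then obtain S where "S \<subseteq> V" "g S = Max (g ` Pow V)" by auto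
  then have S: "S \<subseteq> V" "\<And>T. T \<subseteq> V \<Longrightarrow> g T \<le> g S"
    using Max_ge[OF \<open>finite (g ` Pow V)\<close>] by auto
  have "g {} < g V" using c by (simp add: g_def W_def)
  then have "S \<noteq> {}" using S(2)[of V] by auto
  moreover have "c / 3 \<le> (\<Sum>j\<in>S. \<Sum>k\<in>S. w i j k)" if i: "i \<in> S" for i
  proof -
    define T where "T = S - {i}"
    define d where "d = (\<Sum>j\<in>S. \<Sum>k\<in>S. w i j k)"
    have fS: "finite S" using S(1) V finite_subset by blast
    then have T: "finite T" "i \<notin> T" "S = insert i T" "card S = Suc (card T)" using i
      using card_Suc_Diff1[of S i] by (auto simp: T_def)
    have sub: "(\<Sum>j\<in>A. \<Sum>k\<in>B. w i j k) \<le> d" if "A \<subseteq> S" "B \<subseteq> S" for A B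
    proof -
      have "(\<Sum>j\<in>A. \<Sum>k\<in>B. w i j k) \<le> (\<Sum>j\<in>A. \<Sum>k\<in>S. w i j k)"
        using that fS w(1) by (intro sum_mono sum_mono2) auto
      also have "\<dots> \<le> d"
        unfolding d_def using that fS w(1) by (intro sum_mono2) (auto intro: sum_nonneg)
      finally show ?thesis .
    qed
    \<comment> \<open>Triples are sorted by the first position in which \<open>i\<close> occurs;
      symmetry of \<open>w\<close> then compares each class with \<open>d\<close>.\<close>
    have "W S = d + (\<Sum>x\<in>T. \<Sum>y\<in>S. \<Sum>z\<in>S. w x y z)"
      unfolding W_def d_def by (subst (1) T(3)) (use T in simp)
    also have "(\<Sum>x\<in>T. \<Sum>y\<in>S. \<Sum>z\<in>S. w x y z) =
        (\<Sum>x\<in>T. (\<Sum>z\<in>S. w x i z) + (\<Sum>y\<in>T. w x y i + (\<Sum>z\<in>T. w x y z)))"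
    proof (intro sum.cong refl)
      fix x
      have "(\<Sum>y\<in>S. \<Sum>z\<in>S. w x y z) = (\<Sum>z\<in>S. w x i z) + (\<Sum>y\<in>T. \<Sum>z\<in>S. w x y z)"
        by (subst (1) T(3)) (use T in simp)
      also have "(\<Sum>y\<in>T. \<Sum>z\<in>S. w x y z) = (\<Sum>y\<in>T. w x y i + (\<Sum>z\<in>T. w x y z))"
        unfolding T(3) using T by simp
      finally show "(\<Sum>y\<in>S. \<Sum>z\<in>S. w x y z) = (\<Sum>z\<in>S. w x i z) + (\<Sum>y\<in>T. w x y i + (\<Sum>z\<in>T. w x y z))" .
    qed
    also have "\<dots> = (\<Sum>x\<in>T. \<Sum>z\<in>S. w x i z) + (\<Sum>x\<in>T. \<Sum>y\<in>T. w x y i) + W T"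
      by (simp add: W_def sum.distrib)
    also have "(\<Sum>x\<in>T. \<Sum>z\<in>S. w x i z) = (\<Sum>x\<in>T. \<Sum>z\<in>S. w i x z)"
      by (subst w(2)) (rule refl)
    also have "(\<Sum>x\<in>T. \<Sum>y\<in>T. w x y i) = (\<Sum>x\<in>T. \<Sum>y\<in>T. w i x y)"
      by (intro sum.cong refl) (metis w(2,3))
    finally have "W S = d + ((\<Sum>x\<in>T. \<Sum>z\<in>S. w i x z) + (\<Sum>x\<in>T. \<Sum>y\<in>T. w i x y) + W T)" .
    moreover have TS: "T \<subseteq> S" using T by auto
    ultimately have "W S \<le> W T + 3 * d"
      using sub[OF TS subset_refl] sub[OF TS TS] by linarith
    moreover have "g T \<le> g S" using S(2)[of T] S(1) T by auto
    ultimately show ?thesis using T by (simp add: g_def d_def algebra_simps)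
  qed
  ultimately show ?thesis using S(1) by blast
qed

section \<open>Affine dimension and independent coordinates\<close>

context vec_space
begin

text \<open>The exchange lemma bounds every independent subset of \<open>span X\<close> by
  \<open>card G\<close>. So a maximal one exists, and since it generates \<open>span X\<close>, its
  size bounds the dimension.\<close>

lemma dim_span_le_card:
  assumes G: "finite G" "G \<subseteq> carrier_vec n" and X: "X \<subseteq> span G"
  shows "vectorspace.dim class_ring (vs (span X)) \<le> card G"
proof -
  have XV: "X \<subseteq> carrier_vec n" using X span_closed[OF G(2)] by auto
  have W: "span X \<subseteq> span G" using span_is_subset[OF X span_is_submodule[OF G(2)]] .
  have sW: "submodule class_ring (span X) V" by (rule span_is_submodule[OF XV])
  interpret VW: vectorspace class_ring "vs (span X)"
    by (rule subspace_is_vs[OF span_is_subspace[OF XV]])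
  have li: "finite S \<and> card S \<le> card G" if "S \<subseteq> span X \<and> VW.lin_indpt S" for S
  proof -
    have S: "S \<subseteq> span X" "lin_indpt S" using that span_li_not_depend(2)[OF _ sW] by auto
    have SV: "S \<subseteq> carrier_vec n" using S(1) W span_closed[OF G(2)] by auto
    have "finite S" using li_le_dim(1)[OF fin_dim _ S(2)] SV by simp
    then show ?thesis
      using replacement[OF _ G(1) G(2) S(2)] S(1) W by fastforce
  qed
  have "VW.lin_indpt {}" by (simp add: VW.lin_dep_def)
  then obtain b where b: "maximal b (\<lambda>S. S \<subseteq> span X \<and> VW.lin_indpt S)"
    using maximal_exists[of "\<lambda>S. S \<subseteq> span X \<and> VW.lin_indpt S" "card G" "{}"] li by auto
  then have b': "b \<subseteq> span X \<and> VW.lin_indpt b" by (simp add: maximal_def)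
  have "VW.gen_set b" using VW.max_li_is_gen b by simp
  then have "VW.dim \<le> card b" using VW.gen_ge_dim[of b] li[OF b'] b' by simp
  then show ?thesis using li[OF b'] by linarith
qed

text \<open>Affine combinations and their differences stay in the linear span. Linear dimension may
  exceed affine dimension by one, which is harmless for an upper bound.\<close>

lemma affine_dim_le_card:
  assumes G: "finite G" "G \<subseteq> carrier_vec n" and S: "S \<subseteq> span G"
  shows "affine_dim S \<le> card G"
proof -
  have SV: "S \<subseteq> carrier_vec n" using S span_closed[OF G(2)] by auto
  have "affine_span S \<subseteq> span S" by (auto simp: affine_span_def span_def)
  also have "\<dots> \<subseteq> span G" using span_is_subset[OF S span_is_submodule[OF G(2)]] .
  finally have aff: "affine_span S \<subseteq> span G" .
  have "x - y \<in> span G" if "x \<in> affine_span S" "y \<in> affine_span S" for x y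
  proof -
    have xy: "x \<in> span G" "y \<in> span G" using that aff by auto
    then have c: "x \<in> carrier_vec n" "y \<in> carrier_vec n" using span_closed[OF G(2)] by auto
    have "x + (-1) \<cdot>\<^sub>v y \<in> span G" using G(2) xy by (intro span_add1 smult_in_span) auto
    moreover have "x + (-1) \<cdot>\<^sub>v y = x - y" using c by (intro eq_vecI) auto
    ultimately show ?thesis by simp
  qed
  then show ?thesis unfolding affine_dim_def by (intro dim_span_le_card[OF G]) auto
qed

end

text \<open>Row rank equals column rank: a maximal set \<open>A\<close> of coordinates independent
  on \<open>S\<close> determines all the others linearly, so \<open>card A\<close> vectors span
  \<open>S\<close>.\<close>

lemma affine_dim_le_indep_coordinates:
  assumes S: "S \<subseteq> carrier_vec d"
  obtains A where "A \<subseteq> {..<d}" "indep_on S A (\<lambda>a v. v $ a)"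
    "vec_space.affine_dim d S \<le> card A"
proof -
  interpret vec_space "TYPE(complex)" d .
  define P where "P A \<longleftrightarrow> A \<subseteq> {..<d} \<and> indep_on S A (\<lambda>a v. v $ a)" for A
  have "P {}" by (simp add: P_def indep_on_def)
  moreover have "\<And>A. P A \<Longrightarrow> finite A \<and> card A \<le> d"
    unfolding P_def using finite_subset[of _ "{..<d}"] card_mono[of "{..<d}"] by fastforce
  ultimately obtain A where "finite A" and A: "maximal A P"
    using maximal_exists[of P d "{}"] by blast
  then have PA: "A \<subseteq> {..<d}" "indep_on S A (\<lambda>a v. v $ a)" by (auto simp: maximal_def P_def)
  have "\<exists>m. \<forall>v\<in>S. v $ b = (\<Sum>a\<in>A. m a * v $ a)" if b: "b < d" for b
  proof (cases "b \<in> A")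
    case True
    then show ?thesis using \<open>finite A\<close>
      by (intro exI[of _ "\<lambda>a. if a = b then 1 else 0"])
        (simp add: if_distrib[of "\<lambda>x. x * _"] cong: if_cong)
  next
    case False
    then have "\<not> P (insert b A)" using A unfolding maximal_def by blast
    then have "\<not> indep_on S (insert b A) (\<lambda>a v. v $ a)" using PA(1) b by (simp add: P_def)
    then obtain c x where c: "\<forall>v\<in>S. (\<Sum>a\<in>insert b A. c a * v $ a) = 0" "x \<in> insert b A" "c x \<noteq> 0"
      unfolding indep_on_def by blast
    then have *: "\<forall>v\<in>S. c b * v $ b + (\<Sum>a\<in>A. c a * v $ a) = 0" using False \<open>finite A\<close> by simp
    have "c b \<noteq> 0"
    proof
      assume "c b = 0"
      with * have "\<forall>a\<in>A. c a = 0" using PA(2) unfolding indep_on_def by simp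
      then show False using c(2,3) \<open>c b = 0\<close> by auto
    qed
    have "v $ b = (\<Sum>a\<in>A. (- c a / c b) * v $ a)" if "v \<in> S" for v
    proof -
      have "c b * v $ b = - (\<Sum>a\<in>A. c a * v $ a)" using * that by (simp add: eq_neg_iff_add_eq_0)
      then have "v $ b = - (\<Sum>a\<in>A. c a * v $ a) / c b" using \<open>c b \<noteq> 0\<close> by (simp add: field_simps)
      then show ?thesis by (simp add: sum_divide_distrib sum_negf)
    qed
    then show ?thesis by (intro exI[of _ "\<lambda>a. - c a / c b"] ballI)
  qed
  then have "\<forall>b\<in>{..<d}. \<exists>m. \<forall>v\<in>S. v $ b = (\<Sum>a\<in>A. m a * v $ a)" by simp
  then obtain m where "\<forall>b\<in>{..<d}. \<forall>v\<in>S. v $ b = (\<Sum>a\<in>A. m b a * v $ a)"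
    by (rule bchoice[THEN exE])
  then have m: "\<And>b v. b < d \<Longrightarrow> v \<in> S \<Longrightarrow> v $ b = (\<Sum>a\<in>A. m b a * v $ a)" by simp
  \<comment> \<open>The columns of the coefficient matrix \<open>m\<close>; each
    \<open>v \<in> S\<close> is their combination with coefficients \<open>v $ a\<close>.\<close>
  define G where "G = (\<lambda>a. vec d (\<lambda>b. m b a)) ` A"
  have G: "finite G" "G \<subseteq> carrier_vec d" using \<open>finite A\<close> by (auto simp: G_def)
  have part: "vec d (\<lambda>b. \<Sum>a\<in>F. m b a * v $ a) \<in> span G" if "finite F" "F \<subseteq> A" for F v
    using that
  proof (induction F rule: finite_induct)
    case empty
    then show ?case using span_zero[of G] by (simp add: zero_vec_def)
  next
    case (insert x F)
    have "vec d (\<lambda>b. m b x) \<in> span G" using insert G by (intro span_mem) (auto simp: G_def)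
    then have "vec d (\<lambda>b. \<Sum>a\<in>F. m b a * v $ a) + v $ x \<cdot>\<^sub>v vec d (\<lambda>b. m b x) \<in> span G"
      using insert G by (intro span_add1 smult_in_span) auto
    moreover have "vec d (\<lambda>b. \<Sum>a\<in>F. m b a * v $ a) + v $ x \<cdot>\<^sub>v vec d (\<lambda>b. m b x) =
        vec d (\<lambda>b. \<Sum>a\<in>insert x F. m b a * v $ a)"
      using insert by (intro eq_vecI) (auto simp: algebra_simps)
    ultimately show ?case by simp
  qed
  have "S \<subseteq> span G"
  proof
    fix v assume v: "v \<in> S"
    then have "v = vec d (\<lambda>b. \<Sum>a\<in>A. m b a * v $ a)" using S m by (intro eq_vecI) auto
    then show "v \<in> span G" using part[OF \<open>finite A\<close> subset_refl, of v] by simp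
  qed
  then have "affine_dim S \<le> card G" by (rule affine_dim_le_card[OF G])
  also have "\<dots> \<le> card A" unfolding G_def by (rule card_image_le[OF \<open>finite A\<close>])
  finally show ?thesis using that PA by blast
qed

section \<open>Special lines\<close>

definition line_through :: "complex vec \<Rightarrow> complex vec \<Rightarrow> complex vec set" where
  "line_through x y = {x + t \<cdot>\<^sub>v (y - x) | t. True}"

lemma complex_line_line_through:
  assumes "x \<in> carrier_vec d" "y \<in> carrier_vec d" "x \<noteq> y"
  shows "complex_line d (line_through x y)" "x \<in> line_through x y" "y \<in> line_through x y"
proof -
  have "y - x \<noteq> 0\<^sub>v d"
  proof
    assume 0: "y - x = 0\<^sub>v d"
    have "y = (y - x) + x" using assms(1,2) by (intro eq_vecI) auto
    also have "\<dots> = x" unfolding 0 using assms(1) by simp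
    finally show False using assms(3) by simp
  qed
  moreover have "y - x \<in> carrier_vec d" using assms by simp
  ultimately show "complex_line d (line_through x y)"
    unfolding complex_line_def line_through_def
    by (intro bexI[of _ x] bexI[of _ "y - x"] conjI refl assms(1))
  have "x = x + 0 \<cdot>\<^sub>v (y - x)" using assms(1,2) by (intro eq_vecI) auto
  then show "x \<in> line_through x y" unfolding line_through_def by blast
  have "y = x + 1 \<cdot>\<^sub>v (y - x)" using assms(1,2) by (intro eq_vecI) auto
  then show "y \<in> line_through x y" unfolding line_through_def by blast
qed

text \<open>Two distinct points of \<open>L\<close> differ by a nonzero multiple of the direction,
  so the two parametrisations differ by an affine change of parameter.\<close>

lemma complex_line_eq_line_through:
  assumes L: "complex_line d L" and xy: "x \<in> L" "y \<in> L" "x \<noteq> y"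
  shows "L = line_through x y"
proof -
  obtain a u where au: "a \<in> carrier_vec d" "u \<in> carrier_vec d" "L = {a + t \<cdot>\<^sub>v u | t. True}"
    using L by (auto simp: complex_line_def)
  obtain s t where st: "x = a + s \<cdot>\<^sub>v u" "y = a + t \<cdot>\<^sub>v u" using xy au by auto
  have ne: "t - s \<noteq> 0" using st xy by auto
  have 1: "x + r \<cdot>\<^sub>v (y - x) = a + (s + r * (t - s)) \<cdot>\<^sub>v u" for r
    using au by (intro eq_vecI) (auto simp: st algebra_simps)
  have 2: "a + r \<cdot>\<^sub>v u = x + ((r - s) / (t - s)) \<cdot>\<^sub>v (y - x)" for r
    unfolding 1 using ne by simp
  show ?thesis unfolding au(3) line_through_def
  proof (intro equalityI subsetI; clarify)
    fix r show "\<exists>t. a + r \<cdot>\<^sub>v u = x + t \<cdot>\<^sub>v (y - x) \<and> True" using 2 by blast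
  next
    fix r show "\<exists>t. x + r \<cdot>\<^sub>v (y - x) = a + t \<cdot>\<^sub>v u \<and> True" using 1 by blast
  qed
qed

text \<open>For finite \<open>V\<close> the divisor in the first case is at least 1, as the line
  then contains three points. The value depends only on the line, whence the symmetry in all
  arguments.\<close>

definition triple_weight :: "complex vec set \<Rightarrow> complex vec \<Rightarrow> complex vec \<Rightarrow> complex vec \<Rightarrow> real" where
  "triple_weight V x y z =
     (if {x, y, z} \<subseteq> V \<and> x \<noteq> y \<and> x \<noteq> z \<and> y \<noteq> z \<and> z \<in> line_through x y
      then 1 / (real (card (line_through x y \<inter> V)) - 2) else 0)"

context
  fixes V :: "complex vec set" and d :: nat
  assumes V: "finite V" "V \<subseteq> carrier_vec d"
begin

lemma line_through_V:
  assumes "x \<in> V" "y \<in> V" "x \<noteq> y"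
  shows "complex_line d (line_through x y)" "x \<in> line_through x y" "y \<in> line_through x y"
  by (rule complex_line_line_through; use V assms in blast)+

lemma line_through_commute:
  assumes "x \<in> V" "y \<in> V"
  shows "line_through x y = line_through y x"
proof (cases "x = y")
  case False
  note L = line_through_V[OF assms(2,1) False[symmetric]]
  show ?thesis by (rule complex_line_eq_line_through[OF L(1,3,2) False, symmetric])
qed simp

lemma line_through_swap:
  assumes "x \<in> V" "y \<in> V" "x \<noteq> y" "x \<noteq> z" "z \<in> line_through x y"
  shows "line_through x z = line_through x y" "y \<in> line_through x z"
proof -
  note L = line_through_V[OF assms(1-3)]
  show "line_through x z = line_through x y"
    by (rule complex_line_eq_line_through[OF L(1,2) assms(5,4), symmetric])
  then show "y \<in> line_through x z" using L(3) by simp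
qed

lemma triple_weight_commute12: "triple_weight V x y z = triple_weight V y x z"
  using line_through_commute[of x y] unfolding triple_weight_def by auto

lemma triple_weight_commute23: "triple_weight V x y z = triple_weight V x z y"
proof -
  define P where "P y z \<longleftrightarrow> {x, y, z} \<subseteq> V \<and> x \<noteq> y \<and> x \<noteq> z \<and> y \<noteq> z \<and> z \<in> line_through x y" for y z
  have eq: "triple_weight V x y z = triple_weight V x z y" if "P y z" for y z
  proof -
    note P = that[unfolded P_def]
    have L: "line_through x z = line_through x y" "y \<in> line_through x z"
      using line_through_swap[of x y z] P by blast+
    have "{x, z, y} \<subseteq> V \<and> x \<noteq> z \<and> x \<noteq> y \<and> z \<noteq> y \<and> y \<in> line_through x z"
      using P L(2) by blast
    then show ?thesis unfolding triple_weight_def using P L(1) by (simp only: if_True)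
  qed
  show ?thesis
  proof (cases "P y z \<or> P z y")
    case True
    then show ?thesis using eq[of y z] eq[of z y] by metis
  next
    case False
    then have "\<not> P y z" "\<not> P z y" by auto
    then show ?thesis unfolding triple_weight_def P_def[symmetric] by simp
  qed
qed

lemma card_line_ge_2:
  assumes "x \<in> V" "y \<in> V" "x \<noteq> y"
  shows "2 \<le> card (line_through x y \<inter> V)"
proof -
  have "{x, y} \<subseteq> line_through x y \<inter> V" using line_through_V[OF assms] assms by blast
  then have "card {x, y} \<le> card (line_through x y \<inter> V)" by (rule card_mono[OF finite_Int[OF disjI2[OF V(1)]]])
  then show ?thesis using assms(3) by simp
qed

lemma triple_weight_nonneg: "0 \<le> triple_weight V x y z"
  using card_line_ge_2[of x y] by (auto simp: triple_weight_def)

lemma sum_triple_weight: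
  assumes xy: "x \<in> V" "y \<in> V" "x \<noteq> y"
  shows "(\<Sum>z\<in>V. triple_weight V x y z) = (if 3 \<le> card (line_through x y \<inter> V) then 1 else 0)"
proof -
  define L where "L = line_through x y \<inter> V"
  have L: "finite L" "{x, y} \<subseteq> L" "2 \<le> card L"
    unfolding L_def using V(1) line_through_V[OF xy] xy card_line_ge_2[OF xy] by blast+
  have "(\<Sum>z\<in>V. triple_weight V x y z) = (\<Sum>z\<in>L - {x, y}. 1 / (real (card L) - 2))"
    using V xy by (intro sum.mono_neutral_cong_right) (auto simp: triple_weight_def L_def)
  \<comment> \<open>For a line with exactly two points this is \<open>0 / 0\<close>, which is 0 by
    convention, as the claim requires.\<close>
  also have "\<dots> = real (card L - 2) / (real (card L) - 2)"
    using L xy by (simp add: card_Diff_subset)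
  finally show ?thesis using L(3) by (auto simp: L_def of_nat_diff)
qed

lemma sum_triple_weight_le_1:
  assumes "x \<in> V" "y \<in> V" "S \<subseteq> V"
  shows "(\<Sum>z\<in>S. triple_weight V x y z) \<le> 1"
proof (cases "x = y")
  case False
  have "(\<Sum>z\<in>S. triple_weight V x y z) \<le> (\<Sum>z\<in>V. triple_weight V x y z)"
    using assms V triple_weight_nonneg by (intro sum_mono2) auto
  also have "\<dots> \<le> 1" using sum_triple_weight[of x y] assms False by simp
  finally show ?thesis .
qed (simp add: triple_weight_def)

text \<open>Each special pair is the image of an ordered pair in \<open>Z\<close>, and every such
  ordered pair has total weight 1. The factor 2 between ordered and unordered pairs is given
  away.\<close>

lemma card_special_pairs_le:
  "real (card (special_pairs d V)) \<le> (\<Sum>x\<in>V. \<Sum>y\<in>V. \<Sum>z\<in>V. triple_weight V x y z)"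
proof -
  define Z where "Z = {(x, y) \<in> V \<times> V. x \<noteq> y \<and> 3 \<le> card (line_through x y \<inter> V)}"
  have fZ: "finite Z" using V by (auto simp: Z_def intro: finite_subset[of _ "V \<times> V"])
  have "special_pairs d V \<subseteq> (\<lambda>(x, y). {x, y}) ` Z"
    using complex_line_eq_line_through by (fastforce simp: special_pairs_def special_line_def Z_def)
  then have "card (special_pairs d V) \<le> card Z"
    by (rule surj_card_le[OF fZ])
  also have "real (card Z) = (\<Sum>p\<in>Z. 1)" by simp
  also have "\<dots> \<le> (\<Sum>p\<in>V \<times> V. \<Sum>z\<in>V. triple_weight V (fst p) (snd p) z)"
  proof -
    have "(\<Sum>p\<in>Z. 1) \<le> (\<Sum>p\<in>Z. \<Sum>z\<in>V. triple_weight V (fst p) (snd p) z)"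
      by (intro sum_mono) (auto simp: Z_def sum_triple_weight)
    also have "\<dots> \<le> (\<Sum>p\<in>V \<times> V. \<Sum>z\<in>V. triple_weight V (fst p) (snd p) z)"
      using V triple_weight_nonneg by (intro sum_mono2) (auto simp: Z_def intro!: sum_nonneg)
    finally show ?thesis by simp
  qed
  finally show ?thesis
    using sum.cartesian_product[of "\<lambda>x y. \<Sum>z\<in>V. triple_weight V x y z" V V]
    by (simp add: split_def)
qed

end

section \<open>From many special pairs to a large subset of small dimension\<close>

theorem corollary1p11:
  shows "\<exists>C > (0::real). \<forall>(d::nat) (\<delta>::real) (n::nat) (V :: complex vec set).
    \<delta> > 0 \<longrightarrow> finite V \<longrightarrow> V \<subseteq> carrier_vec d \<longrightarrow> card V = n \<longrightarrow>
    real (card (special_pairs d V)) \<ge> \<delta> * (real n)\<^sup>2 \<longrightarrow>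
    (\<exists>V' \<subseteq> V. real (card V') \<ge> (\<delta> / 6) * real n \<and>
      real (vec_space.affine_dim d V') \<le> C / \<delta>)"
proof (intro exI[of _ 144] conjI allI impI)
  fix d n :: nat and \<delta> :: real and V :: "complex vec set"
  assume \<delta>: "0 < \<delta>" and V: "finite V" "V \<subseteq> carrier_vec d" and n: "card V = n"
    and pairs: "\<delta> * (real n)\<^sup>2 \<le> real (card (special_pairs d V))"
  define w where "w = triple_weight V"
  have w: "\<And>x y z. 0 \<le> w x y z" "\<And>x y z. w x y z = w y x z" "\<And>x y z. w x y z = w x z y"
    unfolding w_def
    by (rule triple_weight_nonneg[OF V] triple_weight_commute12[OF V] triple_weight_commute23[OF V])+
  show "\<exists>V' \<subseteq> V. real (card V') \<ge> (\<delta> / 6) * real n \<and>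
      real (vec_space.affine_dim d V') \<le> 144 / \<delta>"
  proof (cases "n = 0")
    case True
    interpret vec_space "TYPE(complex)" d .
    have "affine_dim {} \<le> card ({} :: complex vec set)" by (rule affine_dim_le_card) auto
    then show ?thesis using True \<delta> by (intro exI[of _ "{}"]) auto
  next
    case False
    define K where "K = \<delta> / 6 * real n"
    have K: "0 < K" using \<delta> False by (simp add: K_def)
    \<comment> \<open>Halving makes the inequality strict, as \<open>heavy_subset\<close> demands;
      its division by 3 then yields \<open>K\<close>.\<close>
    have "(\<delta> * real n / 2) * card V < \<delta> * (real n)\<^sup>2"
      using \<delta> False by (simp add: n power2_eq_square)
    also note pairs
    also note card_special_pairs_le[OF V]
    finally have tot: "(\<delta> * real n / 2) * card V < (\<Sum>x\<in>V. \<Sum>y\<in>V. \<Sum>z\<in>V. w x y z)"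
      by (simp only: w_def)
    obtain S where S: "S \<subseteq> V" "S \<noteq> {}"
        "\<And>x. x \<in> S \<Longrightarrow> (\<delta> * real n / 2) / 3 \<le> (\<Sum>y\<in>S. \<Sum>z\<in>S. w x y z)"
      using heavy_subset[OF V(1) w tot] by blast
    have deg: "\<And>x. x \<in> S \<Longrightarrow> K \<le> (\<Sum>y\<in>S. \<Sum>z\<in>S. w x y z)"
      using S(3) by (simp add: K_def)
    have pair: "(\<Sum>z\<in>S. w x y z) \<le> 1" if "x \<in> S" "y \<in> S" for x y
      unfolding w_def using that S(1) by (intro sum_triple_weight_le_1[OF V]) auto
    have fS: "finite S" using S(1) V(1) finite_subset by blast
    obtain x where x: "x \<in> S" using S(2) by blast
    \<comment> \<open>The weight at a single point is at most the number of choices for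
      \<open>y\<close>, so \<open>S\<close> is large.\<close>
    have "K \<le> (\<Sum>y\<in>S. \<Sum>z\<in>S. w x y z)" by (rule deg[OF x])
    also have "\<dots> \<le> (\<Sum>y\<in>S. 1)" using pair x by (intro sum_mono) auto
    finally have card: "K \<le> card S" by simp
    \<comment> \<open>Functions that are affine along every line: they include the coordinates, are
      closed under elimination, and satisfy a common relation on each collinear triple.\<close>
    define R :: "(complex vec \<Rightarrow> complex) set" where "R = {f. \<forall>x\<in>carrier_vec d. \<forall>y\<in>carrier_vec d. \<forall>t.
      f (x + t \<cdot>\<^sub>v (y - x)) = (1 - t) * f x + t * f y}"
    have R: "(\<lambda>v. f v - t * g v) \<in> R" if "f \<in> R" "g \<in> R" for f g t
      unfolding R_def
    proof (intro CollectI ballI allI)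
      fix x y :: "complex vec" and s assume "x \<in> carrier_vec d" "y \<in> carrier_vec d"
      then have fg: "f (x + s \<cdot>\<^sub>v (y - x)) = (1 - s) * f x + s * f y"
          "g (x + s \<cdot>\<^sub>v (y - x)) = (1 - s) * g x + s * g y"
        using that by (auto simp: R_def)
      show "f (x + s \<cdot>\<^sub>v (y - x)) - t * g (x + s \<cdot>\<^sub>v (y - x)) =
          (1 - s) * (f x - t * g x) + s * (f y - t * g y)"
        unfolding fg by (simp add: algebra_simps)
    qed
    have dep: "\<exists>a b c. a \<noteq> 0 \<and> b \<noteq> 0 \<and> c \<noteq> 0 \<and> (\<forall>f\<in>R. a * f x + b * f y + c * f z = 0)"
      if "w x y z \<noteq> 0" "x \<in> S" "y \<in> S" "z \<in> S" for x y z
    proof -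
      have ne: "x \<noteq> y" "x \<noteq> z" "y \<noteq> z" and "z \<in> line_through x y"
        using that(1) by (auto simp: w_def triple_weight_def split: if_splits)
      then obtain t where t: "z = x + t \<cdot>\<^sub>v (y - x)" by (auto simp: line_through_def)
      have c: "x \<in> carrier_vec d" "y \<in> carrier_vec d" using that S(1) V(2) by auto
      have "x + 0 \<cdot>\<^sub>v (y - x) = x" using c by (intro eq_vecI) auto
      moreover have "x + 1 \<cdot>\<^sub>v (y - x) = y" using c by (intro eq_vecI) auto
      ultimately have "t \<noteq> 0" "t \<noteq> 1" using t ne by auto
      \<comment> \<open>All three coefficients are nonzero because the three points are
        distinct.\<close>
      moreover have "(1 - t) * f x + t * f y + (-1) * f z = 0" if "f \<in> R" for f
        using that c unfolding t R_def by simp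
      ultimately show ?thesis
        by (intro exI[of _ "1 - t"] exI[of _ t] exI[of _ "-1"]) auto
    qed
    obtain A where A: "A \<subseteq> {..<d}" "indep_on S A (\<lambda>a v. v $ a)"
        "vec_space.affine_dim d S \<le> card A"
      using affine_dim_le_indep_coordinates[of S d] S(1) V(2) by blast
    have fA: "finite A" using A(1) finite_subset by blast
    have coord: "(\<lambda>v. v $ a) \<in> R" if "a \<in> A" for a
      using that A(1) by (auto simp: R_def algebra_simps)
    have "real (card A) * K \<le> 24 * real (card S)"
      by (rule design_bound[where R = R and e = "\<lambda>a v. v $ a" and w = w])
        (fact fS fA A(2) coord R w pair deg K dep)+
    also have "\<dots> \<le> 24 * real n" using card_mono[OF V(1) S(1)] n by simp
    \<comment> \<open>Dividing by \<open>K = \<delta> / 6 * n\<close> cancels \<open>n\<close> and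
      leaves \<open>24 * 6 = 144\<close>.\<close>
    finally have "real (card A) \<le> 144 / \<delta>"
      using \<delta> False by (simp add: K_def field_simps)
    then show ?thesis using S(1) card A(3) by (intro exI[of _ S]) (auto simp: K_def)
  qed
qed simp

end
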